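(* Let $A\in\mathbb{R}^{n\times n}$ and $C_i\in\mathbb{R}^{p_i\times n}$, $i=1,\dots,N$, be jointly observable, and let $A_u,V_u$ be the matrices defined in the context. Let $\sigma:[0,\infty)\to\{1,\dots,p\}$ be a switching signal with a positive dwell time and $\mathcal G_1,\dots,\mathcal G_p$ directed graphs on $\{1,\dots,N\}$ with Laplacians $\mathcal L_1,\dots,\mathcal L_p$. Suppose that the switching graph $\mathcal G_{\sigma(t)}$ is jointly strongly connected, that it is uniformly connected on average, and that its average graph $\mathcal G$ is strongly connected. For $\epsilon>0$ consider the linear system $$\dot z=\big[A_u-\gamma V_u^T(\mathcal L_{\sigma(t/\epsilon)}\otimes I_n)V_u\big]z .$$ Then for every sufficiently large $\gamma>0$ there exists $\varepsilon^*>0$ such that, for every $0<\epsilon<\varepsilon^*$ and every initial condition, this system is exponentially stable at the origin.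
   Context: Joint observability: the pair $(C,A)$ with $C=\begin{bmatrix}C_1^T&\cdots&C_N^T\end{bmatrix}^T$ is observable. Let $\mathcal O_i$ be the observability matrix of $(C_i,A)$, i.e. the stack of $C_i,C_iA,\dots,C_iA^{n-1}$, and $v_i=\operatorname{rank}\mathcal O_i$. Let $V_{ui}\in\mathbb{R}^{n\times(n-v_i)}$ have columns forming an orthonormal basis of $\ker\mathcal O_i$ and put $A_{ui}=V_{ui}^TAV_{ui}$. Set $V_u=\operatorname{diag}(V_{u1},\dots,V_{uN})$ and $A_u=\operatorname{diag}(A_{u1},\dots,A_{uN})$ (block diagonal; blocks of size zero are allowed). The state is $z=(z_1,\dots,z_N)$ with $z_i\in\mathbb{R}^{n-v_i}$. Graphs: a directed graph on $\{1,\dots,N\}$ has nonnegative adjacency weights $a_{ij}$, $a_{ii}=0$, with an edge $(j,i)$ iff $a_{ij}>0$; its Laplacian has entries $l_{ii}=\sum_ja_{ij}$, $l_{ij}=-a_{ij}$ for $i\neq j$. A switching signal with dwell time $\tau>0$ is a piecewise constant right-continuous function whose consecutive switching instants $t_0<t_1<\cdots$ are at least $\tau$ apart. Joint strong connectivity of the switching graph: there is a subsequence $\{i_k\}$ of $\{0,1,2,\dots\}$ with $t_{i_{k+1}}-t_{i_k}<\upsilon$ for some $\upsilon>0$ such that each union graph $\bigcup_{j=i_k}^{i_{k+1}-1}\mathcal G_{\sigma(t_j)}$ is strongly connected. Uniformly connected on average: the limit $\mathcal L=\lim_{T\to\infty}\frac1T\int_t^{t+T}\mathcal L_{\sigma(s)}\,ds$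 exists and is the same for all $t\ge0$, the convergence is uniform in the sense that there is a continuous strictly decreasing $\delta:[0,\infty)\to[0,\infty)$ with $\lim_{T\to\infty}\delta(T)=0$ and $\left\|\frac1T\int_t^{t+T}\mathcal L_{\sigma(s)}ds-\mathcal L\right\|\le\delta(T)$ for all $t\ge0$, $T>0$, and the average graph $\mathcal G$ (the graph having Laplacian $\mathcal L$) is connected. Exponential stability of a linear time-varying system: there are $k,\lambda>0$ such that every solution satisfies $\|z(t)\|\le k\|z(t_0)\|e^{-\lambda(t-t_0)}$ for all $t\ge t_0\ge0$. *)

theory Defs
  imports
    "HOL-Analysis.Analysis"
    "Graph_Theory.Digraph_Component"
    "Jordan_Normal_Form.Matrix_Kernel"
    "Jordan_Normal_Form.DL_Rank"
begin

unbundle no vec_syntax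
no_notation inner (infix \<open>\<bullet>\<close> 70)

section \<open>Observability\<close>

definition stack_rows :: "nat \<Rightarrow> real mat list \<Rightarrow> real mat" where
  "stack_rows n Ms = foldr (@\<^sub>r) Ms (0\<^sub>m 0 n)"

definition obs_mat :: "nat \<Rightarrow> real mat \<Rightarrow> real mat \<Rightarrow> real mat" where
  "obs_mat n C A = stack_rows n (map (\<lambda>k. C * A ^\<^sub>m k) [0..<n])"

definition mat_rank :: "real mat \<Rightarrow> nat" where
  "mat_rank M = vec_space.rank (dim_row M) M"

definition observable :: "nat \<Rightarrow> real mat \<Rightarrow> real mat \<Rightarrow> bool" where
  "observable n C A \<longleftrightarrow> mat_rank (obs_mat n C A) = n"

text \<open>The columns of \<open>V\<close> form an orthonormal basis of the kernel of \<open>M\<close>.  Orthonormality makes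
  the columns pairwise distinct, so passing to the set of columns loses nothing.\<close>

definition orthonormal_kernel_basis :: "nat \<Rightarrow> real mat \<Rightarrow> real mat \<Rightarrow> bool" where
  "orthonormal_kernel_basis n M V \<longleftrightarrow>
     V \<in> carrier_mat n (n - mat_rank M) \<and>
     (\<forall>i<dim_col V. \<forall>j<dim_col V. col V i \<bullet> col V j = (if i = j then 1 else 0)) \<and>
     kernel.basis n M (set (cols V))"

section \<open>Weighted directed graphs\<close>

text \<open>A weighted digraph on the vertices \<open>0, \<dots>, N - 1\<close> is given by its adjacency matrix \<open>W\<close>;
  the entry \<open>W $$ (i, j)\<close> is the weight of the edge from \<open>j\<close> to \<open>i\<close>.\<close>

definition weighted_graph :: "nat \<Rightarrow> real mat \<Rightarrow> bool" where
  "weighted_graph N W \<longleftrightarrow> W \<in> carrier_mat N N \<and>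
     (\<forall>i<N. \<forall>j<N. 0 \<le> W $$ (i, j)) \<and> (\<forall>i<N. W $$ (i, i) = 0)"

definition graph_of :: "nat \<Rightarrow> real mat \<Rightarrow> nat pair_pre_digraph" where
  "graph_of N W = \<lparr>pverts = {..<N}, parcs = {(j, i). j < N \<and> i < N \<and> W $$ (i, j) > 0}\<rparr>"

definition union_graph :: "nat \<Rightarrow> real mat set \<Rightarrow> nat pair_pre_digraph" where
  "union_graph N Ws = \<lparr>pverts = {..<N}, parcs = (\<Union>W\<in>Ws. parcs (graph_of N W))\<rparr>"

definition laplacian :: "nat \<Rightarrow> real mat \<Rightarrow> real mat" where
  "laplacian N W = mat N N (\<lambda>(i, j). if i = j then (\<Sum>k<N. W $$ (i, k)) else - W $$ (i, j))"

section \<open>Switching signals\<close>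

text \<open>Between consecutive instants the signal is constant on half-open intervals closed on the left,
  which encodes right continuity.  The instants need not be proper jumps, so a signal with finitely
  many jumps is included.  The first instant may be \<open>0\<close> or positive.\<close>

definition switching_signal :: "nat \<Rightarrow> real \<Rightarrow> (nat \<Rightarrow> real) \<Rightarrow> (real \<Rightarrow> nat) \<Rightarrow> bool" where
  "switching_signal p \<tau> ts \<sigma> \<longleftrightarrow>
     0 < \<tau> \<and> 0 \<le> ts 0 \<and> (\<forall>k. \<tau> \<le> ts (Suc k) - ts k) \<and>
     (\<forall>t\<ge>0. \<sigma> t \<in> {1..p}) \<and>
     (\<forall>t\<in>{0..<ts 0}. \<sigma> t = \<sigma> 0) \<and>
     (\<forall>k. \<forall>t\<in>{ts k..<ts (Suc k)}. \<sigma> t = \<sigma> (ts k))"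

definition jointly_strongly_connected ::
    "nat \<Rightarrow> (nat \<Rightarrow> real mat) \<Rightarrow> (nat \<Rightarrow> real) \<Rightarrow> (real \<Rightarrow> nat) \<Rightarrow> bool" where
  "jointly_strongly_connected N W ts \<sigma> \<longleftrightarrow>
     (\<exists>\<iota> :: nat \<Rightarrow> nat. strict_mono \<iota> \<and>
        (\<exists>\<upsilon>>0. \<forall>k. ts (\<iota> (Suc k)) - ts (\<iota> k) < \<upsilon>) \<and>
        (\<forall>k. strongly_connected (with_proj
               (union_graph N ((\<lambda>j. W (\<sigma> (ts j))) ` {\<iota> k..<\<iota> (Suc k)})))))"

section \<open>Norms\<close>

definition vnorm :: "real vec \<Rightarrow> real" where
  "vnorm x = sqrt (x \<bullet> x)"

text \<open>The matrix norm induced by the Euclidean norm.\<close>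

definition mnorm :: "real mat \<Rightarrow> real" where
  "mnorm M = (SUP x\<in>{x \<in> carrier_vec (dim_col M). vnorm x \<le> 1}. vnorm (M *\<^sub>v x))"

section \<open>Connectivity on average\<close>

definition average_laplacian ::
    "nat \<Rightarrow> (nat \<Rightarrow> real mat) \<Rightarrow> (real \<Rightarrow> nat) \<Rightarrow> real \<Rightarrow> real \<Rightarrow> real mat" where
  "average_laplacian N W \<sigma> t T =
     mat N N (\<lambda>(i, j). 1 / T * integral {t..t + T} (\<lambda>s. laplacian N (W (\<sigma> s)) $$ (i, j)))"

text \<open>\<open>Wavg\<close> is the average graph.  It is determined by its Laplacian, hence by \<open>W\<close> and \<open>\<sigma>\<close>.\<close>

definition uniformly_connected_on_average ::
    "nat \<Rightarrow> (nat \<Rightarrow> real mat) \<Rightarrow> (real \<Rightarrow> nat) \<Rightarrow> real mat \<Rightarrow> bool" where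
  "uniformly_connected_on_average N W \<sigma> Wavg \<longleftrightarrow>
     weighted_graph N Wavg \<and>
     (\<forall>t\<ge>0. \<forall>i<N. \<forall>j<N.
        ((\<lambda>T. average_laplacian N W \<sigma> t T $$ (i, j)) \<longlongrightarrow> laplacian N Wavg $$ (i, j)) at_top) \<and>
     (\<exists>\<delta> :: real \<Rightarrow> real. continuous_on {0..} \<delta> \<and> strict_antimono_on {0..} \<delta> \<and>
        (\<forall>T\<ge>0. 0 \<le> \<delta> T) \<and> (\<delta> \<longlongrightarrow> 0) at_top \<and>
        (\<forall>t\<ge>0. \<forall>T>0. mnorm (average_laplacian N W \<sigma> t T - laplacian N Wavg) \<le> \<delta> T)) \<and>
     Digraph_Component.connected (with_proj (graph_of N Wavg))"

section \<open>Linear time-varying systems\<close>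

definition kronecker :: "real mat \<Rightarrow> real mat \<Rightarrow> real mat" where
  "kronecker A B = mat (dim_row A * dim_row B) (dim_col A * dim_col B)
     (\<lambda>(i, j). A $$ (i div dim_row B, j div dim_col B) * B $$ (i mod dim_row B, j mod dim_col B))"

text \<open>Solutions of \<open>z' = M t z\<close> on \<open>[t0, \<infinity>)\<close> for a possibly discontinuous \<open>M\<close>: continuous, and
  differentiable with the prescribed derivative outside an exceptional set that meets every bounded
  interval in finitely many points.\<close>

definition ltv_solution ::
    "nat \<Rightarrow> (real \<Rightarrow> real mat) \<Rightarrow> real \<Rightarrow> (real \<Rightarrow> real vec) \<Rightarrow> bool" where
  "ltv_solution d M t0 z \<longleftrightarrow>
     (\<forall>t\<ge>t0. z t \<in> carrier_vec d) \<and>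
     (\<forall>k<d. continuous_on {t0..} (\<lambda>t. z t $ k)) \<and>
     (\<exists>S. (\<forall>t. finite (S \<inter> {t0..t})) \<and>
        (\<forall>t\<in>{t0<..} - S. \<forall>k<d. ((\<lambda>s. z s $ k) has_real_derivative (M t *\<^sub>v z t) $ k) (at t)))"

definition ltv_exponentially_stable :: "nat \<Rightarrow> (real \<Rightarrow> real mat) \<Rightarrow> bool" where
  "ltv_exponentially_stable d M \<longleftrightarrow>
     (\<exists>k>0. \<exists>\<alpha>>0. \<forall>t0\<ge>0. \<forall>z. ltv_solution d M t0 z \<longrightarrow>
        (\<forall>t\<ge>t0. vnorm (z t) \<le> k * vnorm (z t0) * exp (- \<alpha> * (t - t0))))"

end

theory Submission
  imports Defs
begin

text \<open>
  The Laplacian of the strongly connected average graph has a positive left null vector \<open>\<theta>\<close>.  With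
  \<open>Y\<^sub>i\<close> the \<open>i\<close>-th block of \<open>V\<^sub>u x\<close>, the form \<open>x\<^sup>T \<Theta> V\<^sub>u\<^sup>T (L \<otimes> I) V\<^sub>u x\<close> equals
  \<open>1/2 \<Sum> \<theta>\<^sub>i a\<^sub>i\<^sub>j |Y\<^sub>i - Y\<^sub>j|\<^sup>2\<close>.  It vanishes only if all \<open>Y\<^sub>i\<close> agree; the common value then lies in
  every unobservable subspace, hence is \<open>0\<close>.  So the form is coercive, and for large \<open>\<gamma>\<close> the function
  \<open>\<Sum> \<theta>\<^bsub>block j\<^esub> x\<^sub>j\<^sup>2\<close> is a strict Lyapunov function of the averaged system.

  Over a window of length \<open>h = \<epsilon> T\<close> a solution of the switched system satisfies
  \<open>z (t + h) = (I + h M + h E) z t\<close>, where \<open>M\<close> is the averaged matrix and the error \<open>E\<close> consists of the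
  averaging error of windows of length \<open>T\<close> and a term of order \<open>h\<close>.  Choosing first \<open>T\<close> large and then
  \<open>\<epsilon>\<close> small, the Lyapunov function contracts by a fixed factor over every window.
\<close>

section \<open>Observability and stacked matrices\<close>

text \<open>Full column rank makes the columns linearly independent. Dependence is a property of the
  set of columns, so distinctness is settled first: with a repeated column, every independent subset
  of the columns would have fewer than \<open>n\<close> elements.\<close>

lemma full_rank_mult_eq_0:
  assumes A: "A \<in> carrier_mat m n" and rk: "mat_rank A = n"
    and v: "v \<in> carrier_vec n" and Av: "A *\<^sub>v v = 0\<^sub>v m"
  shows "v = 0\<^sub>v n"
proof (rule ccontr)
  assume nz: "v \<noteq> 0\<^sub>v n"
  interpret vec_space "TYPE(real)" m .
  have rank: "rank A = n"
    using rk A by (simp add: mat_rank_def)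
  have "distinct (cols A)"
  proof (rule ccontr)
    assume nd: "\<not> distinct (cols A)"
    obtain S where S: "maximal S (\<lambda>T. T \<subseteq> set (cols A) \<and> lin_indpt T)"
      using maximal_exists[of "(\<lambda>T. T \<subseteq> set (cols A) \<and> lin_indpt T)" "card (set (cols A))" "{}"]
      by (meson List.finite_set card_mono empty_iff empty_subsetI finite_lin_indpt2 rev_finite_subset)
    have "card S \<le> card (set (cols A))"
      using S by (simp add: card_mono maximal_def)
    also have "\<dots> < length (cols A)"
      using nd card_distinct card_length le_neq_implies_less by blast
    finally show False
      using rank_card_indpt[OF A S] rank A by simp
  qed
  then show False
    using lin_depI[OF A v nz Av] full_rank_lin_indpt[OF A rank] by blast
qed

lemma stack_rows_carrier:
  assumes "\<And>M. M \<in> set Ms \<Longrightarrow> dim_col M = n"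
  shows "stack_rows n Ms \<in> carrier_mat (sum_list (map dim_row Ms)) n"
  using assms
proof (induction Ms)
  case (Cons M Ms)
  have "M \<in> carrier_mat (dim_row M) n"
    using Cons.prems[of M] by (intro carrier_matI) simp_all
  moreover have "stack_rows n Ms \<in> carrier_mat (sum_list (map dim_row Ms)) n"
    by (rule Cons.IH) (use Cons.prems in simp)
  ultimately have "M @\<^sub>r stack_rows n Ms \<in> carrier_mat (dim_row M + sum_list (map dim_row Ms)) n"
    by (rule carrier_append_rows)
  then show ?case
    by (simp add: stack_rows_def)
qed (simp add: stack_rows_def)

lemma stack_rows_mult_eq_0_iff:
  assumes "\<And>M. M \<in> set Ms \<Longrightarrow> dim_col M = n" and x: "x \<in> carrier_vec n"
  shows "stack_rows n Ms *\<^sub>v x = 0\<^sub>v (sum_list (map dim_row Ms)) \<longleftrightarrow>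
    (\<forall>M\<in>set Ms. M *\<^sub>v x = 0\<^sub>v (dim_row M))"
  using assms(1)
proof (induction Ms)
  case Nil
  show ?case by (auto simp: stack_rows_def)
next
  case (Cons M Ms)
  let ?k = "sum_list (map dim_row Ms)"
  have M: "M \<in> carrier_mat (dim_row M) n"
    using Cons.prems[of M] by (intro carrier_matI) simp_all
  have S: "stack_rows n Ms \<in> carrier_mat ?k n"
    by (rule stack_rows_carrier) (rule Cons.prems, rule list.set_intros(2))
  have "stack_rows n (M # Ms) *\<^sub>v x = (M *\<^sub>v x) @\<^sub>v (stack_rows n Ms *\<^sub>v x)"
    using mat_mult_append[OF M S x] by (simp add: stack_rows_def)
  moreover have "0\<^sub>v (sum_list (map dim_row (M # Ms))) = 0\<^sub>v (dim_row M) @\<^sub>v (0\<^sub>v ?k :: real vec)"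
    by (intro eq_vecI) auto
  ultimately have "stack_rows n (M # Ms) *\<^sub>v x = 0\<^sub>v (sum_list (map dim_row (M # Ms))) \<longleftrightarrow>
    (M *\<^sub>v x) @\<^sub>v (stack_rows n Ms *\<^sub>v x) = 0\<^sub>v (dim_row M) @\<^sub>v 0\<^sub>v ?k"
    by (rule arg_cong2)
  also have "\<dots> \<longleftrightarrow> M *\<^sub>v x = 0\<^sub>v (dim_row M) \<and> stack_rows n Ms *\<^sub>v x = 0\<^sub>v ?k"
    by (rule append_vec_eq[OF mult_mat_vec_carrier[OF M x] zero_carrier_vec])
  also have "stack_rows n Ms *\<^sub>v x = 0\<^sub>v ?k \<longleftrightarrow> (\<forall>M\<in>set Ms. M *\<^sub>v x = 0\<^sub>v (dim_row M))"
    by (rule Cons.IH) (rule Cons.prems, rule list.set_intros(2))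
  finally show ?case
    by (simp only: list.set ball_simps)
qed

lemma obs_mat_carrier:
  assumes A: "A \<in> carrier_mat n n"
  shows "obs_mat n C A \<in> carrier_mat (dim_row (obs_mat n C A)) n"
proof -
  have "dim_col M = n" if "M \<in> set (map (\<lambda>k. C * A ^\<^sub>m k) [0..<n])" for M
    using that carrier_matD(2)[OF pow_carrier_mat[OF A]] by auto
  from stack_rows_carrier[OF this] show ?thesis
    unfolding obs_mat_def by (intro carrier_matI refl) (rule carrier_matD(2))
qed

lemma obs_mat_mult_eq_0_iff:
  assumes A: "A \<in> carrier_mat n n" and C: "C \<in> carrier_mat q n" and x: "x \<in> carrier_vec n"
  shows "obs_mat n C A *\<^sub>v x = 0\<^sub>v (dim_row (obs_mat n C A)) \<longleftrightarrow>
    (\<forall>k<n. C *\<^sub>v (A ^\<^sub>m k *\<^sub>v x) = 0\<^sub>v q)"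
proof -
  let ?Ms = "map (\<lambda>k. C * A ^\<^sub>m k) [0..<n]"
  have Ak: "A ^\<^sub>m k \<in> carrier_mat n n" for k
    using A by (rule pow_carrier_mat)
  have d: "dim_col M = n" if "M \<in> set ?Ms" for M
    using that carrier_matD(2)[OF Ak] by auto
  have "dim_row (obs_mat n C A) = sum_list (map dim_row ?Ms)"
    using stack_rows_carrier[of ?Ms n] d unfolding obs_mat_def by blast
  then have "obs_mat n C A *\<^sub>v x = 0\<^sub>v (dim_row (obs_mat n C A)) \<longleftrightarrow>
    (\<forall>M\<in>set ?Ms. M *\<^sub>v x = 0\<^sub>v (dim_row M))"
    using stack_rows_mult_eq_0_iff[of ?Ms n x] d x unfolding obs_mat_def by simp
  also have "\<dots> \<longleftrightarrow> (\<forall>k<n. C *\<^sub>v (A ^\<^sub>m k *\<^sub>v x) = 0\<^sub>v q)"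
    using C assoc_mult_mat_vec[OF C Ak x] by auto
  finally show ?thesis .
qed

text \<open>A vector in the kernel of every \<open>obs_mat n (C i) A\<close> is annihilated by all
  \<open>C i * A ^\<^sub>m k\<close> with \<open>k < n\<close>, hence by the observability matrix of
  the stacked outputs, whose kernel is trivial by full rank.\<close>

lemma jointly_observable_eq_0:
  assumes A: "A \<in> carrier_mat n n" and C: "\<And>i. i < N \<Longrightarrow> C i \<in> carrier_mat (q i) n"
    and obs: "observable n (stack_rows n (map C [0..<N])) A"
    and x: "x \<in> carrier_vec n"
    and ker: "\<And>i. i < N \<Longrightarrow> obs_mat n (C i) A *\<^sub>v x = 0\<^sub>v (dim_row (obs_mat n (C i) A))"
  shows "x = 0\<^sub>v n"
proof -
  let ?C = "stack_rows n (map C [0..<N])" and ?r = "sum_list (map dim_row (map C [0..<N]))"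
  let ?O = "obs_mat n ?C A"
  have d: "dim_col M = n" if "M \<in> set (map C [0..<N])" for M
    using that carrier_matD(2)[OF C] by auto
  have SC: "?C \<in> carrier_mat ?r n"
    using d by (rule stack_rows_carrier)
  have Akx: "A ^\<^sub>m k *\<^sub>v x \<in> carrier_vec n" for k
    using A x by (meson mult_mat_vec_carrier pow_carrier_mat)
  have "?C *\<^sub>v (A ^\<^sub>m k *\<^sub>v x) = 0\<^sub>v ?r" if "k < n" for k
  proof -
    have "C i *\<^sub>v (A ^\<^sub>m k *\<^sub>v x) = 0\<^sub>v (q i)" if "i < N" for i
      using obs_mat_mult_eq_0_iff[OF A C[OF that] x] ker[OF that] \<open>k < n\<close> by blast
    then have "\<forall>M\<in>set (map C [0..<N]). M *\<^sub>v (A ^\<^sub>m k *\<^sub>v x) = 0\<^sub>v (dim_row M)"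
      using carrier_matD(1)[OF C] by simp
    then show ?thesis
      using stack_rows_mult_eq_0_iff[OF d Akx[of k]] by blast
  qed
  then have "?O *\<^sub>v x = 0\<^sub>v (dim_row ?O)"
    using obs_mat_mult_eq_0_iff[OF A SC x] by blast
  moreover have "?O \<in> carrier_mat (dim_row ?O) n"
    by (rule obs_mat_carrier) (rule A)
  ultimately show ?thesis
    using full_rank_mult_eq_0 x obs unfolding observable_def by blast
qed

section \<open>Block diagonal matrices\<close>

text \<open>Coordinates are addressed as block offset plus position inside the block. The same
  splitting serves the unobservable coordinates, with block sizes \<open>d i\<close>, and the rows
  of \<open>Vu\<close>, with constant size \<open>n\<close>.\<close>

lemma sum_concat_blocks:
  fixes f :: "nat \<Rightarrow> 'a :: comm_monoid_add" and N :: nat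
  shows "(\<Sum>j<(\<Sum>i<N. d i). f j) = (\<Sum>i<N. \<Sum>c<d i. f ((\<Sum>k<i. d k) + c))"
proof (induction N)
  case (Suc N)
  have "(\<Sum>j<m + k. f j) = (\<Sum>j<m. f j) + (\<Sum>c<k. f (m + c))" for m k
    by (induction k) (auto simp: add.assoc)
  from this[of "\<Sum>i<N. d i" "d N"] show ?case
    unfolding sum.lessThan_Suc Suc.IH .
qed simp

lemma concat_blocks_index:
  fixes j N :: nat
  assumes "j < (\<Sum>i<N. d i)"
  shows "\<exists>i<N. \<exists>c<d i. j = (\<Sum>k<i. d k) + c"
  using assms
proof (induction N)
  case (Suc N)
  show ?case
  proof (cases "j < (\<Sum>i<N. d i)")
    case True
    then show ?thesis
      using Suc.IH less_SucI by blast
  next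
    case False
    then show ?thesis
      using Suc.prems by (intro exI[of _ N] conjI exI[of _ "j - (\<Sum>i<N. d i)"]) auto
  qed
qed simp

lemma block_offset_less:
  fixes f :: "'a \<Rightarrow> nat"
  assumes "i < length Xs" "r < f (Xs ! i)"
  shows "(\<Sum>l<i. f (Xs ! l)) + r < sum_list (map f Xs)"
proof -
  have "(\<Sum>l<i. f (Xs ! l)) + r < (\<Sum>l<Suc i. f (Xs ! l))"
    using assms by simp
  also have "\<dots> \<le> (\<Sum>l<length Xs. f (Xs ! l))"
    by (rule sum_mono2) (use assms in auto)
  also have "\<dots> = sum_list (map f Xs)"
    by (simp add: sum_list_sum_nth atLeast0LessThan)
  finally show ?thesis .
qed

text \<open>Induction peels off the first block, which shifts all later offsets by its own
  dimensions. Offsets are sums of the preceding dimensions, so blocks of size zero fit in without a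
  separate case.\<close>

lemma diag_block_mat_index:
  assumes "i < length Ms" "k < length Ms" "r < dim_row (Ms ! i)" "c < dim_col (Ms ! k)"
  shows "diag_block_mat Ms $$ ((\<Sum>l<i. dim_row (Ms ! l)) + r, (\<Sum>l<k. dim_col (Ms ! l)) + c) =
    (if i = k then Ms ! i $$ (r, c) else 0)"
  using assms
proof (induction Ms arbitrary: i k)
  case (Cons M Ms)
  define R where "R i = (\<Sum>l<i. dim_row (Ms ! l))" for i
  define K where "K i = (\<Sum>l<i. dim_col (Ms ! l))" for i
  have dim: "dim_row (diag_block_mat Ms) = sum_list (map dim_row Ms)"
    "dim_col (diag_block_mat Ms) = sum_list (map dim_col Ms)"
    by (rule dim_diag_block_mat)+
  have shift: "(\<Sum>l<Suc i. dim_row ((M # Ms) ! l)) = dim_row M + R i"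
    "(\<Sum>l<Suc i. dim_col ((M # Ms) ! l)) = dim_col M + K i" for i
    unfolding R_def K_def sum.lessThan_Suc_shift by simp_all
  have less: "R i + r < sum_list (map dim_row Ms)" if "i < length Ms" "r < dim_row (Ms ! i)" for i r
    unfolding R_def using that by (rule block_offset_less)
  have less': "K i + r < sum_list (map dim_col Ms)" if "i < length Ms" "r < dim_col (Ms ! i)" for i r
    unfolding K_def using that by (rule block_offset_less)
  have IH: "diag_block_mat Ms $$ (R i + r, K k + c) = (if i = k then Ms ! i $$ (r, c) else 0)"
    if "i < length Ms" "k < length Ms" "r < dim_row (Ms ! i)" "c < dim_col (Ms ! k)" for i k
    unfolding R_def K_def using that by (rule Cons.IH)
  show ?case
  proof (cases i)
    case i: 0
    show ?thesis
    proof (cases k)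
      case 0
      then show ?thesis
        using i Cons.prems by (simp add: Let_def)
    next
      case (Suc k')
      then show ?thesis
        using Cons.prems less'[of k' c] unfolding i Suc shift
        by (simp add: Let_def dim)
    qed
  next
    case i: (Suc i')
    show ?thesis
    proof (cases k)
      case 0
      then show ?thesis
        using Cons.prems less[of i' r] unfolding i 0 shift
        by (simp add: Let_def dim)
    next
      case (Suc k')
      then show ?thesis
        using Cons.prems less[of i' r] less'[of k' c] IH[of i' k'] unfolding i Suc shift
        by (simp add: Let_def dim)
    qed
  qed
qed simp

section \<open>Averaging\<close>

text \<open>This replaces Gronwall's inequality. The 1-norm attains its maximum over the window at
  some \<open>t\<close>; integrating the equation bounds that maximum by the initial value plus
  \<open>d * K * h\<close> times the maximum itself, and \<open>d * K * h \<le> 1 / 2\<close> allows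
  it to be absorbed. The integrated form of the equation tolerates jumps of
  \<open>M\<close>.\<close>

lemma window_growth:
  fixes z :: "real \<Rightarrow> nat \<Rightarrow> real" and M :: "real \<Rightarrow> nat \<Rightarrow> nat \<Rightarrow> real"
  assumes cont: "\<And>i. i < d \<Longrightarrow> continuous_on {a..a + h} (\<lambda>t. z t i)"
    and int: "\<And>i s. i < d \<Longrightarrow> s \<in> {a..a + h} \<Longrightarrow>
      ((\<lambda>u. \<Sum>j<d. M u i j * z u j) has_integral (z s i - z a i)) {a..s}"
    and bound: "\<And>u i j. u \<in> {a..a + h} \<Longrightarrow> i < d \<Longrightarrow> j < d \<Longrightarrow> \<bar>M u i j\<bar> \<le> K"
    and h: "0 \<le> h" "0 \<le> K" "d * K * h \<le> 1 / 2"
    and s: "s \<in> {a..a + h}"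
  shows "(\<Sum>i<d. \<bar>z s i\<bar>) \<le> 2 * (\<Sum>i<d. \<bar>z a i\<bar>)"
    and "i < d \<Longrightarrow> \<bar>z s i - z a i\<bar> \<le> 2 * h * K * (\<Sum>i<d. \<bar>z a i\<bar>)"
proof -
  define g where "g t = (\<Sum>i<d. \<bar>z t i\<bar>)" for t
  have "continuous_on {a..a + h} g"
    unfolding g_def by (intro continuous_intros cont) auto
  then obtain t where t: "t \<in> {a..a + h}" and max: "\<And>u. u \<in> {a..a + h} \<Longrightarrow> g u \<le> g t"
    using continuous_attains_sup[of "{a..a + h}" g] h by auto
  have g0: "0 \<le> g u" for u
    by (simp add: g_def sum_nonneg)
  have incr: "\<bar>z u i - z a i\<bar> \<le> h * K * g t" if u: "u \<in> {a..a + h}" and i: "i < d" for u i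
  proof -
    have "norm (\<Sum>j<d. M v i j * z v j) \<le> K * g t" if v: "v \<in> {a..u}" for v
    proof -
      have v': "v \<in> {a..a + h}"
        using v u by auto
      have "norm (\<Sum>j<d. M v i j * z v j) \<le> (\<Sum>j<d. K * \<bar>z v j\<bar>)"
        by (rule sum_norm_le) (auto simp: abs_mult intro!: mult_right_mono bound v' i)
      also have "\<dots> = K * g v"
        by (simp add: g_def sum_distrib_left)
      also have "\<dots> \<le> K * g t"
        using h max v' by (intro mult_left_mono) auto
      finally show ?thesis .
    qed
    then have "norm (z u i - z a i) \<le> K * g t * measure lborel {a..u}"
      using h g0 by (intro has_integral_bound_real[OF _ finite.emptyI int[OF i u]]) auto
    also have "\<dots> = K * g t * (u - a)"
      using u by simp
    also have "\<dots> \<le> K * g t * h"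
      using u h g0 by (intro mult_left_mono) auto
    finally show ?thesis
      by (simp add: mult_ac)
  qed
  have "g t \<le> (\<Sum>i<d. \<bar>z a i\<bar> + h * K * g t)"
    unfolding g_def[of t] by (rule sum_mono) (use incr[OF t] g_def in fastforce)
  also have "\<dots> = g a + d * K * h * g t"
    by (simp add: g_def sum.distrib)
  also have "\<dots> \<le> g a + 1 / 2 * g t"
    using h g0 by (intro add_left_mono mult_right_mono) auto
  finally have gt: "g t \<le> 2 * g a"
    by simp
  then show "(\<Sum>i<d. \<bar>z s i\<bar>) \<le> 2 * (\<Sum>i<d. \<bar>z a i\<bar>)"
    using max[OF s] unfolding g_def by linarith
  show "\<bar>z s i - z a i\<bar> \<le> 2 * h * K * (\<Sum>i<d. \<bar>z a i\<bar>)" if "i < d"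
  proof -
    have "h * K * g t \<le> h * K * (2 * g a)"
      using gt h by (intro mult_left_mono) auto
    with incr[OF s that] show ?thesis
      by (simp add: g_def)
  qed
qed

text \<open>Two errors are separated. Freezing the state at \<open>a\<close> costs second order in
  \<open>h\<close>, since each coordinate moves by at most \<open>2 * h * K\<close> times the
  initial 1-norm; replacing the window average \<open>B\<close> by \<open>Mb\<close> costs at most
  \<open>h * e\<close> times that norm.\<close>

lemma window_increment:
  fixes z :: "real \<Rightarrow> nat \<Rightarrow> real" and M :: "real \<Rightarrow> nat \<Rightarrow> nat \<Rightarrow> real"
  assumes cont: "\<And>i. i < d \<Longrightarrow> continuous_on {a..a + h} (\<lambda>t. z t i)"
    and int: "\<And>i s. i < d \<Longrightarrow> s \<in> {a..a + h} \<Longrightarrow>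
      ((\<lambda>u. \<Sum>j<d. M u i j * z u j) has_integral (z s i - z a i)) {a..s}"
    and bound: "\<And>u i j. u \<in> {a..a + h} \<Longrightarrow> i < d \<Longrightarrow> j < d \<Longrightarrow> \<bar>M u i j\<bar> \<le> K"
    and h: "0 \<le> h" "0 \<le> K" "d * K * h \<le> 1 / 2"
    and avg: "\<And>i j. i < d \<Longrightarrow> j < d \<Longrightarrow> ((\<lambda>u. M u i j) has_integral h * B i j) {a..a + h}"
    and close: "\<And>i j. i < d \<Longrightarrow> j < d \<Longrightarrow> \<bar>B i j - Mb i j\<bar> \<le> e"
    and i: "i < d"
  shows "\<bar>z (a + h) i - z a i - h * (\<Sum>j<d. Mb i j * z a j)\<bar>
    \<le> h * (e + 2 * real d * h * K\<^sup>2) * (\<Sum>i<d. \<bar>z a i\<bar>)"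
proof -
  define g where "g = (\<Sum>i<d. \<bar>z a i\<bar>)"
  have g0: "0 \<le> g"
    by (simp add: g_def sum_nonneg)
  \<comment> \<open>With the state frozen at \<open>a\<close> the integral is exactly
    \<open>h * B\<close> applied to \<open>z a\<close>; only the difference of the integrands has to
    be estimated.\<close>
  have "((\<lambda>u. (\<Sum>j<d. M u i j * z u j) - (\<Sum>j<d. M u i j * z a j)) has_integral
    (z (a + h) i - z a i) - (\<Sum>j<d. h * B i j * z a j)) {a..a + h}"
    using h i by (intro has_integral_diff has_integral_sum has_integral_mult_left int avg) auto
  moreover have "norm ((\<Sum>j<d. M u i j * z u j) - (\<Sum>j<d. M u i j * z a j)) \<le> d * (K * (2 * h * K * g))"
    if u: "u \<in> {a..a + h}" for u
  proof -
    have "norm (M u i j * z u j - M u i j * z a j) \<le> K * (2 * h * K * g)" if "j < d" for j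
    proof -
      have "norm (M u i j * z u j - M u i j * z a j) = \<bar>M u i j\<bar> * \<bar>z u j - z a j\<bar>"
        by (simp add: abs_mult[symmetric] right_diff_distrib)
      also have "\<dots> \<le> K * (2 * h * K * g)"
        using window_growth(2)[OF cont int bound h u that] bound[OF u i that] h
        unfolding g_def by (intro mult_mono) auto
      finally show ?thesis .
    qed
    then have "norm (\<Sum>j<d. M u i j * z u j - M u i j * z a j) \<le> (\<Sum>j<d. K * (2 * h * K * g))"
      by (intro sum_norm_le) auto
    then show ?thesis
      by (simp add: sum_subtractf)
  qed
  ultimately have "norm ((z (a + h) i - z a i) - (\<Sum>j<d. h * B i j * z a j)) \<le> d * (K * (2 * h * K * g)) * measure lborel {a..a + h}"
    using h g0 by (intro has_integral_bound_real[OF _ finite.emptyI]) auto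
  then have 1: "\<bar>(z (a + h) i - z a i) - (\<Sum>j<d. h * B i j * z a j)\<bar> \<le> h * (2 * real d * h * K\<^sup>2) * g"
    using h by (simp add: power2_eq_square mult_ac)
  have "norm (\<Sum>j<d. h * (B i j - Mb i j) * z a j) \<le> (\<Sum>j<d. h * e * \<bar>z a j\<bar>)"
    using h close[OF i] by (intro sum_norm_le) (simp add: abs_mult mult_left_mono mult_right_mono)
  also have "\<dots> = h * e * g"
    by (simp add: g_def sum_distrib_left)
  also have "(\<Sum>j<d. h * (B i j - Mb i j) * z a j) = (\<Sum>j<d. h * B i j * z a j) - h * (\<Sum>j<d. Mb i j * z a j)"
    by (simp add: sum_distrib_left sum_subtractf[symmetric] algebra_simps)
  finally have 2: "\<bar>(\<Sum>j<d. h * B i j * z a j) - h * (\<Sum>j<d. Mb i j * z a j)\<bar> \<le> h * e * g"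
    by simp
  have "h * (e + 2 * real d * h * K\<^sup>2) * g = h * e * g + h * (2 * real d * h * K\<^sup>2) * g"
    by (simp add: algebra_simps)
  then show ?thesis
    using 1 2 unfolding g_def[symmetric] by linarith
qed

text \<open>Here \<open>w\<close> is the increment over a window. In the expansion of
  \<open>(x i + w i)\<^sup>2\<close> the cross terms contribute \<open>- 2 * h * c\<close> times the
  squared norm, up to an error in \<open>\<eta>\<close>, and the squares of \<open>w\<close> are of
  second order in \<open>h\<close>. The last smallness assumption keeps these errors below
  \<open>h * c\<close> times the squared norm, so half of the decrease survives.\<close>

lemma quadratic_decrease:
  fixes x w p :: "nat \<Rightarrow> real" and Mb :: "nat \<Rightarrow> nat \<Rightarrow> real"
  assumes p: "\<And>i. i < d \<Longrightarrow> 0 \<le> p i" "\<And>i. i < d \<Longrightarrow> p i \<le> P" and P: "0 \<le> P"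
    and lyap: "(\<Sum>i<d. p i * x i * (\<Sum>j<d. Mb i j * x j)) \<le> - c * (\<Sum>i<d. (x i)\<^sup>2)"
    and w1: "\<And>i. i < d \<Longrightarrow> \<bar>w i - h * (\<Sum>j<d. Mb i j * x j)\<bar> \<le> h * \<eta> * (\<Sum>i<d. \<bar>x i\<bar>)"
    and w2: "\<And>i. i < d \<Longrightarrow> \<bar>w i\<bar> \<le> 2 * h * K * (\<Sum>i<d. \<bar>x i\<bar>)"
    and h: "0 \<le> h" "0 \<le> K" "0 \<le> \<eta>" "d * (2 * P * \<eta> + 4 * real d * P * h * K\<^sup>2) \<le> c"
  shows "(\<Sum>i<d. p i * (x i + w i)\<^sup>2) \<le> (\<Sum>i<d. p i * (x i)\<^sup>2) - h * c * (\<Sum>i<d. (x i)\<^sup>2)"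
proof -
  define g where "g = (\<Sum>i<d. \<bar>x i\<bar>)"
  define X where "X = (\<Sum>i<d. (x i)\<^sup>2)"
  have g0: "0 \<le> g" and X0: "0 \<le> X"
    by (simp_all add: g_def X_def sum_nonneg)
  have gX: "g\<^sup>2 \<le> d * X"
    using sum_squared_le_sum_of_squares[of "\<lambda>i. \<bar>x i\<bar>" "{..<d}"]
    by (simp add: g_def X_def mult.commute)
  have "p i * x i * w i \<le> h * (p i * x i * (\<Sum>j<d. Mb i j * x j)) + P * \<bar>x i\<bar> * (h * \<eta> * g)"
    if "i < d" for i
  proof -
    define m where "m = (\<Sum>j<d. Mb i j * x j)"
    have "p i * x i * (w i - h * m) \<le> \<bar>p i * x i * (w i - h * m)\<bar>"
      by simp
    also have "\<dots> = p i * \<bar>x i\<bar> * \<bar>w i - h * m\<bar>"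
      using p[OF that] by (simp add: abs_mult)
    also have "\<dots> \<le> P * \<bar>x i\<bar> * (h * \<eta> * g)"
      using p[OF that] w1[OF that] P unfolding g_def m_def by (intro mult_mono mult_right_mono) auto
    finally show ?thesis
      unfolding m_def[symmetric] by (simp add: algebra_simps)
  qed
  then have "(\<Sum>i<d. p i * x i * w i) \<le>
      (\<Sum>i<d. h * (p i * x i * (\<Sum>j<d. Mb i j * x j)) + P * \<bar>x i\<bar> * (h * \<eta> * g))"
    by (intro sum_mono) auto
  also have "\<dots> = h * (\<Sum>i<d. p i * x i * (\<Sum>j<d. Mb i j * x j)) + h * P * \<eta> * g\<^sup>2"
    by (simp add: sum.distrib sum_distrib_left[symmetric] sum_distrib_right[symmetric] g_def[symmetric]
        power2_eq_square mult_ac)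
  also have "\<dots> \<le> h * (- c * X) + h * P * \<eta> * g\<^sup>2"
    using lyap h unfolding X_def by (intro add_right_mono mult_left_mono) auto
  finally have 1: "(\<Sum>i<d. p i * x i * w i) \<le> h * (- c * X) + h * P * \<eta> * g\<^sup>2" .
  have "p i * (w i)\<^sup>2 \<le> P * (2 * h * K * g)\<^sup>2" if "i < d" for i
    using p[OF that] w2[OF that] P h unfolding g_def
    by (intro mult_mono) (auto simp: abs_le_square_iff[symmetric])
  then have "(\<Sum>i<d. p i * (w i)\<^sup>2) \<le> (\<Sum>i<d. P * (2 * h * K * g)\<^sup>2)"
    by (intro sum_mono) auto
  then have 2: "(\<Sum>i<d. p i * (w i)\<^sup>2) \<le> h * (4 * real d * P * h * K\<^sup>2) * g\<^sup>2"
    by (simp add: power2_eq_square mult_ac)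
  have "(\<Sum>i<d. p i * (x i + w i)\<^sup>2) =
      (\<Sum>i<d. p i * (x i)\<^sup>2 + 2 * (p i * x i * w i) + p i * (w i)\<^sup>2)"
    by (rule sum.cong) (simp_all add: power2_eq_square algebra_simps)
  also have "\<dots> =
      (\<Sum>i<d. p i * (x i)\<^sup>2) + 2 * (\<Sum>i<d. p i * x i * w i) + (\<Sum>i<d. p i * (w i)\<^sup>2)"
    by (simp only: sum.distrib sum_distrib_left)
  also have "\<dots> \<le> (\<Sum>i<d. p i * (x i)\<^sup>2) - 2 * h * c * X + h * (2 * P * \<eta> + 4 * real d * P * h * K\<^sup>2) * g\<^sup>2"
    using 1 2 by (simp add: algebra_simps)
  also have "h * (2 * P * \<eta> + 4 * real d * P * h * K\<^sup>2) * g\<^sup>2 \<le> h * (2 * P * \<eta> + 4 * real d * P * h * K\<^sup>2) * (d * X)"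
    using gX h P by (intro mult_left_mono) auto
  also have "\<dots> = h * X * (d * (2 * P * \<eta> + 4 * real d * P * h * K\<^sup>2))"
    by (simp add: algebra_simps)
  also have "\<dots> \<le> h * X * c"
    using h X0 by (intro mult_left_mono) auto
  finally show ?thesis
    unfolding X_def[symmetric] by (simp add: algebra_simps)
qed

text \<open>Iterating \<open>decr\<close> gives geometric decay at the times
  \<open>t0 + k * h\<close>, and \<open>growth\<close> bridges the gap to an arbitrary
  \<open>t\<close>. The constant under the root collects \<open>4\<close> from squaring the growth
  bound, \<open>d\<close> from comparing 1-norm and 2-norm, \<open>P / pm\<close> from comparing
  weighted and plain squares, and \<open>exp a\<close> from rounding \<open>t\<close> down to a
  sampling time.\<close>

lemma sampled_exponential_decay:
  fixes z :: "real \<Rightarrow> nat \<Rightarrow> real" and p :: "nat \<Rightarrow> real"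
  assumes h: "0 < h" and a: "0 < a" and pm: "0 < pm"
    and p: "\<And>i. i < d \<Longrightarrow> pm \<le> p i" "\<And>i. i < d \<Longrightarrow> p i \<le> P" and P: "0 \<le> P"
    and growth: "\<And>t s. t0 \<le> t \<Longrightarrow> s \<in> {t..t + h} \<Longrightarrow> (\<Sum>i<d. \<bar>z s i\<bar>) \<le> 2 * (\<Sum>i<d. \<bar>z t i\<bar>)"
    and decr: "\<And>t. t0 \<le> t \<Longrightarrow> (\<Sum>i<d. p i * (z (t + h) i)\<^sup>2) \<le> exp (- a) * (\<Sum>i<d. p i * (z t i)\<^sup>2)"
    and t: "t0 \<le> t"
  shows "L2_set (z t) {..<d} \<le>
    sqrt (4 * real d * P / pm * exp a) * L2_set (z t0) {..<d} * exp (- (a / (2 * h)) * (t - t0))"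
proof -
  define X where "X t = (\<Sum>i<d. (z t i)\<^sup>2)" for t
  define Q where "Q t = (\<Sum>i<d. p i * (z t i)\<^sup>2)" for t
  define C where "C = 4 * real d * P / pm * exp a"
  have X0: "0 \<le> X t" for t
    by (simp add: X_def sum_nonneg)
  have Q_le: "Q t \<le> P * X t" and Q_ge: "pm * X t \<le> Q t" for t
    unfolding Q_def X_def sum_distrib_left by (auto intro!: sum_mono mult_right_mono p)
  have Qn: "Q (t0 + real k * h) \<le> exp (- a * k) * Q t0" for k
  proof (induction k)
    case (Suc k)
    have "Q (t0 + real k * h + h) \<le> exp (- a) * Q (t0 + real k * h)"
      unfolding Q_def using h by (intro decr) auto
    also have "\<dots> \<le> exp (- a) * (exp (- a * k) * Q t0)"
      using Suc by (intro mult_left_mono) auto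
    finally show ?case
      by (simp add: algebra_simps exp_diff exp_minus field_simps exp_add)
  qed simp
  \<comment> \<open>The number of complete windows in \<open>{t0..t}\<close>, so that
    \<open>s\<close> is the last sampling time not after \<open>t\<close>.\<close>
  define k where "k = nat \<lfloor>(t - t0) / h\<rfloor>"
  define s where "s = t0 + real k * h"
  have k: "real k \<le> (t - t0) / h" "(t - t0) / h < real k + 1"
    using t h by (auto simp: k_def)
  have s: "t0 \<le> s" "t \<in> {s..s + h}"
    using k h by (auto simp: s_def field_simps)
  have "X t \<le> (\<Sum>i<d. \<bar>z t i\<bar>)\<^sup>2"
    using L2_set_le_sum_abs[of "z t" "{..<d}"] X0[of t]
    by (simp add: L2_set_def X_def sum_nonneg sqrt_le_D)
  also have "\<dots> \<le> (2 * (\<Sum>i<d. \<bar>z s i\<bar>))\<^sup>2"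
    using growth[OF s] by (intro power_mono) (auto intro: sum_nonneg)
  also have "\<dots> \<le> 4 * (d * X s)"
    using sum_squared_le_sum_of_squares[of "\<lambda>i. \<bar>z s i\<bar>" "{..<d}"]
    by (simp add: X_def power_mult_distrib mult.commute)
  also have "X s \<le> Q s / pm"
    using Q_ge[of s] pm by (simp add: field_simps)
  also have "Q s \<le> exp (- a * k) * Q t0"
    unfolding s_def by (rule Qn)
  also have "\<dots> \<le> exp (- a * k) * (P * X t0)"
    by (intro mult_left_mono Q_le) auto
  also have "exp (- a * k) \<le> exp (a - a * ((t - t0) / h))"
  proof -
    have "a * ((t - t0) / h) \<le> a * (real k + 1)"
      using k a by (intro mult_left_mono) auto
    then show ?thesis
      by (simp add: algebra_simps)
  qed
  also have "4 * (real d * (exp (a - a * ((t - t0) / h)) * (P * X t0) / pm)) =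
      C * X t0 * exp (- (a / h) * (t - t0))"
    by (simp add: C_def exp_diff exp_minus field_simps)
  \<comment> \<open>The claim is about the norm, not its square, which accounts for the halved rate
    \<open>a / (2 * h)\<close>.\<close>
  also have "\<dots> = (sqrt C * L2_set (z t0) {..<d} * exp (- (a / (2 * h)) * (t - t0)))\<^sup>2"
  proof -
    have "(exp (- (a / (2 * h)) * (t - t0)))\<^sup>2 = exp (- (a / h) * (t - t0))"
      using h by (simp add: exp_double[symmetric] field_simps)
    moreover have "0 \<le> C"
      using P pm by (simp add: C_def)
    ultimately show ?thesis
      using X0[of t0] by (simp add: power_mult_distrib L2_set_def X_def)
  qed
  finally have "X t \<le> (sqrt C * L2_set (z t0) {..<d} * exp (- (a / (2 * h)) * (t - t0)))\<^sup>2"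
    using pm P X0 by (simp add: divide_right_mono mult_left_mono mult_right_mono)
  then show ?thesis
    unfolding C_def[symmetric] L2_set_def[of "z t"] X_def[symmetric]
    by (intro real_le_lsqrt) (simp_all add: C_def P pm less_imp_le L2_set_nonneg)
qed

text \<open>Here \<open>m\<close> is the system matrix in fast time and \<open>Mb\<close> its
  average. Hypothesis \<open>avg\<close> asks, for each accuracy, for a single window length that
  works from every starting time. Since \<open>e\<close> and then \<open>T\<close> are fixed before
  \<open>\<epsilon>\<close>, the window of length \<open>\<epsilon> * T\<close> in slow time can be
  made as short as the second-order errors require.\<close>

lemma averaging_exponential_stability:
  fixes m :: "real \<Rightarrow> nat \<Rightarrow> nat \<Rightarrow> real" and Mb :: "nat \<Rightarrow> nat \<Rightarrow> real" and p :: "nat \<Rightarrow> real"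
  assumes bound: "\<And>s i j. 0 \<le> s \<Longrightarrow> i < d \<Longrightarrow> j < d \<Longrightarrow> \<bar>m s i j\<bar> \<le> K" and K: "0 < K"
    and intble: "\<And>i j a b. i < d \<Longrightarrow> j < d \<Longrightarrow> 0 \<le> a \<Longrightarrow> (\<lambda>s. m s i j) integrable_on {a..b}"
    and avg: "\<And>e. 0 < e \<Longrightarrow>
      \<exists>T>0. \<forall>t\<ge>0. \<forall>i<d. \<forall>j<d. \<bar>1 / T * integral {t..t + T} (\<lambda>s. m s i j) - Mb i j\<bar> \<le> e"
    and p: "\<And>i. i < d \<Longrightarrow> 0 < p i" and c: "0 < c"
    and lyap: "\<And>x. (\<Sum>i<d. p i * x i * (\<Sum>j<d. Mb i j * x j)) \<le> - c * (\<Sum>i<d. (x i)\<^sup>2)"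
  shows "\<exists>\<epsilon>s>0. \<forall>\<epsilon>. 0 < \<epsilon> \<and> \<epsilon> < \<epsilon>s \<longrightarrow> (\<exists>k>0. \<exists>\<alpha>>0. \<forall>t0\<ge>0. \<forall>z S.
    (\<forall>i<d. continuous_on {t0..} (\<lambda>t. z t i)) \<longrightarrow> (\<forall>t. finite (S \<inter> {t0..t})) \<longrightarrow>
    (\<forall>t\<in>{t0<..} - S. \<forall>i<d.
      ((\<lambda>s. z s i) has_real_derivative (\<Sum>j<d. m (t / \<epsilon>) i j * z t j)) (at t)) \<longrightarrow>
    (\<forall>t\<ge>t0. L2_set (z t) {..<d} \<le> k * L2_set (z t0) {..<d} * exp (- \<alpha> * (t - t0))))"
proof -
  \<comment> \<open>Inserting \<open>1\<close> keeps \<open>Max\<close> and \<open>Min\<close>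
    meaningful when \<open>d = 0\<close> and yields \<open>1 \<le> P\<close>.\<close>
  define P where "P = Max (insert 1 (p ` {..<d}))"
  define pm where "pm = Min (insert 1 (p ` {..<d}))"
  have P: "p i \<le> P" "pm \<le> p i" if "i < d" for i
    using that by (auto simp: P_def pm_def)
  have P1: "1 \<le> P"
    by (simp add: P_def)
  have pm: "0 < pm"
    using p by (auto simp: pm_def)
  \<comment> \<open>The shift by one makes \<open>D\<close> a positive divisor even for
    \<open>d = 0\<close>.\<close>
  define D where "D = real d + 1"
  have D: "1 \<le> D" "real d \<le> D"
    by (auto simp: D_def)
  \<comment> \<open>The admissible error \<open>c\<close> is split into halves: \<open>e\<close>
    gives \<open>2 * P * D * e = c / 2\<close>, and the second bound in \<open>h0\<close> gives
    \<open>8 * P * D\<^sup>2 * K\<^sup>2 * h \<le> c / 2\<close>. The first bound in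
    \<open>h0\<close> provides the condition \<open>d * K * h \<le> 1 / 2\<close> of
    \<open>window_growth\<close>.\<close>
  define e where "e = c / (4 * P * D)"
  define h0 where "h0 = min (1 / (2 * D * K)) (c / (16 * P * D\<^sup>2 * K\<^sup>2))"
  have e: "0 < e" and h0: "0 < h0"
    using c P1 D K by (auto simp: e_def h0_def)
  obtain T where T: "0 < T" and avgT: "\<And>t i j. 0 \<le> t \<Longrightarrow> i < d \<Longrightarrow> j < d \<Longrightarrow>
      \<bar>1 / T * integral {t..t + T} (\<lambda>s. m s i j) - Mb i j\<bar> \<le> e"
    using avg[OF e] by blast
  show ?thesis
  proof (rule exI[of _ "h0 / T"], intro conjI allI impI)
    show "0 < h0 / T"
      using h0 T by simp
    fix \<epsilon> :: real
    assume \<epsilon>: "0 < \<epsilon> \<and> \<epsilon> < h0 / T"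
    define h where "h = \<epsilon> * T"
    have h: "0 < h" "h < h0"
      using \<epsilon> T by (auto simp: h_def field_simps)
    have hK: "real d * K * h \<le> 1 / 2"
    proof -
      have "h \<le> 1 / (2 * D * K)"
        using h by (simp add: h0_def)
      then have "D * K * h \<le> 1 / 2"
        using D K by (simp add: field_simps)
      moreover have "real d * (K * h) \<le> D * (K * h)"
        using D K h by (intro mult_right_mono) auto
      ultimately show ?thesis
        by simp
    qed
    have small: "real d * (2 * P * (e + 2 * real d * h * K\<^sup>2) + 4 * real d * P * h * K\<^sup>2) \<le> c"
    proof -
      have "h \<le> c / (16 * P * D\<^sup>2 * K\<^sup>2)"
        using h by (simp add: h0_def)
      then have 1: "8 * P * D * D * K\<^sup>2 * h \<le> c / 2"
        using D K P1 by (simp add: field_simps power2_eq_square)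
      have 2: "2 * P * D * e = c / 2"
        using D P1 by (simp add: e_def)
      have "real d * (2 * P * (e + 2 * real d * h * K\<^sup>2) + 4 * real d * P * h * K\<^sup>2) \<le>
          D * (2 * P * (e + 2 * D * h * K\<^sup>2) + 4 * D * P * h * K\<^sup>2)"
        using D P1 e h by (intro mult_mono add_mono mult_nonneg_nonneg add_nonneg_nonneg) auto
      also have "\<dots> = 2 * P * D * e + 8 * P * D * D * K\<^sup>2 * h"
        by (simp add: algebra_simps)
      finally show ?thesis
        using 1 2 by linarith
    qed
    \<comment> \<open>The weighted sum of squares is at most \<open>P\<close> times the plain one,
      so a decrease by \<open>h * c\<close> times the plain sum is a contraction by the factor
      \<open>1 - a \<le> exp (- a)\<close>.\<close>
    define a where "a = h * c / P"
    have a: "0 < a"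
      using h c P1 by (simp add: a_def)
    have decay: "L2_set (z t) {..<d} \<le>
      sqrt (4 * real d * P / pm * exp a) * L2_set (z t0) {..<d} * exp (- (a / (2 * h)) * (t - t0))"
      if t0: "0 \<le> t0" and cont: "\<forall>i<d. continuous_on {t0..} (\<lambda>t. z t i)"
        and S: "\<forall>t. finite (S \<inter> {t0..t})"
        and deriv: "\<forall>t\<in>{t0<..} - S. \<forall>i<d.
          ((\<lambda>s. z s i) has_real_derivative (\<Sum>j<d. m (t / \<epsilon>) i j * z t j)) (at t)"
        and t: "t0 \<le> t"
      for t0 t z S
    proof -
      define M where "M u = m (u / \<epsilon>)" for u
      have int: "((\<lambda>u. \<Sum>j<d. M u i j * z u j) has_integral (z s i - z b i)) {b..s}"
        if "i < d" "t0 \<le> b" "b \<le> s" for i b s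
      proof (rule fundamental_theorem_of_calculus_interior_strong[of "S \<inter> {t0..s}"])
        show "((\<lambda>t. z t i) has_vector_derivative (\<Sum>j<d. M u i j * z u j)) (at u)"
          if "u \<in> {b<..<s} - S \<inter> {t0..s}" for u
          using deriv that \<open>i < d\<close> \<open>t0 \<le> b\<close>
          unfolding has_real_derivative_iff_has_vector_derivative[symmetric] M_def by auto
        show "continuous_on {b..s} (\<lambda>t. z t i)"
          using cont that by (auto intro: continuous_on_subset)
      qed (use S that in auto)
      have bM: "\<bar>M u i j\<bar> \<le> K" if "i < d" "j < d" "t0 \<le> u" for u i j
        unfolding M_def using that t0 \<epsilon> by (intro bound) auto
      have cont': "continuous_on {b..b + h} (\<lambda>t. z t i)" if "i < d" "t0 \<le> b" for i b
        using cont that by (auto intro: continuous_on_subset)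
      \<comment> \<open>The window \<open>{b..b + h}\<close> is the image under scaling by
        \<open>\<epsilon>\<close> of a fast-time window of length \<open>T\<close>, so the average
        of \<open>M\<close> over it is one of those controlled by \<open>avgT\<close>.\<close>
      define B where "B b i j = 1 / T * integral {b / \<epsilon>..b / \<epsilon> + T} (\<lambda>s. m s i j)" for b i j
      have B: "((\<lambda>u. M u i j) has_integral h * B b i j) {b..b + h}"
        if "i < d" "j < d" "t0 \<le> b" for b i j
      proof -
        have "((\<lambda>s. m s i j) has_integral (T * B b i j)) {b / \<epsilon>..b / \<epsilon> + T}"
          using intble[OF that(1,2), of "b / \<epsilon>" "b / \<epsilon> + T"] that t0 \<epsilon> T
          by (simp add: B_def integrable_integral)
        from has_integral_stretch_real[OF this, of "1 / \<epsilon>"]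
        have "((\<lambda>u. m (u / \<epsilon>) i j) has_integral (h * B b i j)) ((\<lambda>x. \<epsilon> * x) ` {b / \<epsilon>..b / \<epsilon> + T})"
          using \<epsilon> by (simp add: h_def mult_ac)
        moreover have "(\<lambda>x. \<epsilon> * x) ` {b / \<epsilon>..b / \<epsilon> + T} = {b..b + h}"
          using \<epsilon> T by (simp add: h_def distrib_left image_mult_atLeastAtMost)
        ultimately show ?thesis
          by (simp add: M_def)
      qed
      have close: "\<bar>B b i j - Mb i j\<bar> \<le> e" if "i < d" "j < d" "t0 \<le> b" for b i j
        unfolding B_def using that t0 \<epsilon> by (intro avgT) auto
      have growth: "(\<Sum>i<d. \<bar>z s i\<bar>) \<le> 2 * (\<Sum>i<d. \<bar>z b i\<bar>)"
        if "t0 \<le> b" "s \<in> {b..b + h}" for b s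
        by (rule window_growth(1)[where M = M and K = K and h = h])
          (use that h K hK in \<open>auto intro: cont' int bM\<close>)
      have decr: "(\<Sum>i<d. p i * (z (b + h) i)\<^sup>2) \<le> exp (- a) * (\<Sum>i<d. p i * (z b i)\<^sup>2)"
        if b: "t0 \<le> b" for b
      proof -
        define w where "w i = z (b + h) i - z b i" for i
        define g where "g = (\<Sum>i<d. \<bar>z b i\<bar>)"
        have w2: "\<bar>w i\<bar> \<le> 2 * h * K * g" if "i < d" for i
          unfolding w_def g_def
          by (rule window_growth(2)[where M = M and K = K and h = h])
            (use that b h K hK in \<open>auto intro: cont' int bM\<close>)
        have w1: "\<bar>w i - h * (\<Sum>j<d. Mb i j * z b j)\<bar> \<le> h * (e + 2 * real d * h * K\<^sup>2) * g" if "i < d" for i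
          unfolding w_def g_def
          by (rule window_increment[where M = M and B = "B b"])
            (use that b h K hK in \<open>auto intro: cont' int bM B close\<close>)
        have "(\<Sum>i<d. p i * (z b i + w i)\<^sup>2) \<le> (\<Sum>i<d. p i * (z b i)\<^sup>2) - h * c * (\<Sum>i<d. (z b i)\<^sup>2)"
          by (rule quadratic_decrease[OF _ P(1) _ lyap w1[unfolded g_def] w2[unfolded g_def] _ _ _ small])
            (use p P1 h K e in \<open>auto intro: less_imp_le\<close>)
        also have "\<dots> \<le> (1 - a) * (\<Sum>i<d. p i * (z b i)\<^sup>2)"
        proof -
          have "(\<Sum>i<d. p i * (z b i)\<^sup>2) \<le> P * (\<Sum>i<d. (z b i)\<^sup>2)"
            unfolding sum_distrib_left by (intro sum_mono mult_right_mono P) auto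
          then have "a * (\<Sum>i<d. p i * (z b i)\<^sup>2) \<le> a * (P * (\<Sum>i<d. (z b i)\<^sup>2))"
            using a by (intro mult_left_mono) auto
          also have "\<dots> = h * c * (\<Sum>i<d. (z b i)\<^sup>2)"
            using P1 by (simp add: a_def)
          finally show ?thesis
            by (simp add: algebra_simps)
        qed
        also have "\<dots> \<le> exp (- a) * (\<Sum>i<d. p i * (z b i)\<^sup>2)"
          using exp_ge_add_one_self[of "- a"] p
          by (intro mult_right_mono sum_nonneg mult_nonneg_nonneg) (auto intro: less_imp_le)
        finally show ?thesis
          by (simp add: w_def)
      qed
      show ?thesis
        by (rule sampled_exponential_decay[where p = p and h = h])
          (use h a pm P P1 t in \<open>auto intro: growth decr\<close>)
    qed
    \<comment> \<open>Adding \<open>1\<close> ensures a positive constant when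
      \<open>d = 0\<close>.\<close>
    let ?k = "sqrt (4 * real d * P / pm * exp a) + 1"
    have "0 < ?k"
      using P1 pm by (intro add_nonneg_pos) auto
    moreover have "\<exists>\<alpha>>0. \<forall>t0\<ge>0. \<forall>z S.
      (\<forall>i<d. continuous_on {t0..} (\<lambda>t. z t i)) \<longrightarrow> (\<forall>t. finite (S \<inter> {t0..t})) \<longrightarrow>
      (\<forall>t\<in>{t0<..} - S. \<forall>i<d.
        ((\<lambda>s. z s i) has_real_derivative (\<Sum>j<d. m (t / \<epsilon>) i j * z t j)) (at t)) \<longrightarrow>
      (\<forall>t\<ge>t0. L2_set (z t) {..<d} \<le> ?k * L2_set (z t0) {..<d} * exp (- \<alpha> * (t - t0)))"
    proof (rule exI[of _ "a / (2 * h)"], intro conjI allI impI)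
      show "0 < a / (2 * h)"
        using a h by simp
      fix t0 t z S
      assume "0 \<le> t0" "\<forall>i<d. continuous_on {t0..} (\<lambda>t. z t i)" "\<forall>t. finite (S \<inter> {t0..t})"
        "\<forall>t\<in>{t0<..} - S. \<forall>i<d.
          ((\<lambda>s. z s i) has_real_derivative (\<Sum>j<d. m (t / \<epsilon>) i j * z t j)) (at t)" "t0 \<le> t"
      note decay[OF this]
      also have "sqrt (4 * real d * P / pm * exp a) * L2_set (z t0) {..<d} * exp (- (a / (2 * h)) * (t - t0))
          \<le> ?k * L2_set (z t0) {..<d} * exp (- (a / (2 * h)) * (t - t0))"
        by (intro mult_right_mono) (auto simp: L2_set_nonneg)
      finally show "L2_set (z t) {..<d} \<le> ?k * L2_set (z t0) {..<d} * exp (- (a / (2 * h)) * (t - t0))" .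
    qed
    ultimately show "\<exists>k>0. \<exists>\<alpha>>0. \<forall>t0\<ge>0. \<forall>z S.
      (\<forall>i<d. continuous_on {t0..} (\<lambda>t. z t i)) \<longrightarrow> (\<forall>t. finite (S \<inter> {t0..t})) \<longrightarrow>
      (\<forall>t\<in>{t0<..} - S. \<forall>i<d.
        ((\<lambda>s. z s i) has_real_derivative (\<Sum>j<d. m (t / \<epsilon>) i j * z t j)) (at t)) \<longrightarrow>
      (\<forall>t\<ge>t0. L2_set (z t) {..<d} \<le> k * L2_set (z t0) {..<d} * exp (- \<alpha> * (t - t0)))"
      by blast
  qed
qed

section \<open>Matrix entries and switching signals\<close>

lemma mult_mat_vec_index:
  assumes "A \<in> carrier_mat n m" "v \<in> carrier_vec m" "i < n"
  shows "(A *\<^sub>v v) $ i = (\<Sum>j<m. A $$ (i, j) * v $ j)"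
  using assms by (auto simp: scalar_prod_def atLeast0LessThan intro!: sum.cong)

lemma mult_mat_index:
  assumes "A \<in> carrier_mat n m" "B \<in> carrier_mat m k" "i < n" "j < k"
  shows "(A * B) $$ (i, j) = (\<Sum>l<m. A $$ (i, l) * B $$ (l, j))"
  using assms by (auto simp: scalar_prod_def atLeast0LessThan intro!: sum.cong)

lemma vnorm_eq_L2_set: "vnorm x = L2_set (\<lambda>i. x $ i) {..<dim_vec x}"
  by (simp add: vnorm_def L2_set_def scalar_prod_def power2_eq_square atLeast0LessThan)

text \<open>The entry is a coordinate of the image of a unit vector. The supremum in
  \<open>mnorm\<close> bounds its members only once the set is known to be bounded, which the sum of
  all absolute entries provides.\<close>

lemma abs_index_le_mnorm:
  assumes ij: "i < dim_row M" "j < dim_col M"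
  shows "\<bar>M $$ (i, j)\<bar> \<le> mnorm M"
proof -
  let ?X = "{x \<in> carrier_vec (dim_col M). vnorm x \<le> 1}"
  have "vnorm (M *\<^sub>v x) \<le> (\<Sum>i<dim_row M. \<Sum>j<dim_col M. \<bar>M $$ (i, j)\<bar>)" if x: "x \<in> ?X" for x
  proof -
    have x1: "\<bar>x $ j\<bar> \<le> 1" if "j < dim_col M" for j
    proof -
      have "\<bar>x $ j\<bar> \<le> L2_set (\<lambda>i. \<bar>x $ i\<bar>) {..<dim_vec x}"
        using x that by (intro member_le_L2_set) auto
      moreover have "L2_set (\<lambda>i. \<bar>x $ i\<bar>) {..<dim_vec x} = vnorm x"
        by (simp add: vnorm_eq_L2_set L2_set_def)
      ultimately show ?thesis
        using x by simp
    qed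
    have "\<bar>(M *\<^sub>v x) $ i\<bar> \<le> (\<Sum>j<dim_col M. \<bar>M $$ (i, j)\<bar>)" if "i < dim_row M" for i
    proof -
      have "(M *\<^sub>v x) $ i = (\<Sum>j<dim_col M. M $$ (i, j) * x $ j)"
        using x that by (auto simp: scalar_prod_def atLeast0LessThan intro!: sum.cong)
      also have "norm \<dots> \<le> (\<Sum>j<dim_col M. \<bar>M $$ (i, j)\<bar>)"
        using x1 by (intro sum_norm_le) (simp add: abs_mult mult_left_le)
      finally show ?thesis
        by simp
    qed
    then have "(\<Sum>i<dim_row M. \<bar>(M *\<^sub>v x) $ i\<bar>) \<le> (\<Sum>i<dim_row M. \<Sum>j<dim_col M. \<bar>M $$ (i, j)\<bar>)"
      by (intro sum_mono) auto
    moreover have "vnorm (M *\<^sub>v x) \<le> (\<Sum>i<dim_row M. \<bar>(M *\<^sub>v x) $ i\<bar>)"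
      unfolding vnorm_eq_L2_set dim_mult_mat_vec by (rule L2_set_le_sum_abs)
    ultimately show ?thesis
      by linarith
  qed
  then have bdd: "bdd_above ((\<lambda>x. vnorm (M *\<^sub>v x)) ` ?X)"
    by (rule bdd_aboveI2)
  have "unit_vec (dim_col M) j \<in> ?X"
    using ij by (simp add: vnorm_def)
  then have "vnorm (M *\<^sub>v unit_vec (dim_col M) j) \<le> mnorm M"
    unfolding mnorm_def using bdd by (rule cSUP_upper)
  moreover have "\<bar>(M *\<^sub>v unit_vec (dim_col M) j) $ i\<bar> \<le>
      L2_set (\<lambda>i. \<bar>(M *\<^sub>v unit_vec (dim_col M) j) $ i\<bar>) {..<dim_row M}"
    using ij by (intro member_le_L2_set) auto
  moreover have "(M *\<^sub>v unit_vec (dim_col M) j) $ i = M $$ (i, j)"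
    using ij by simp
  ultimately show ?thesis
    by (simp add: vnorm_eq_L2_set L2_set_def)
qed

text \<open>The dwell time gives \<open>k * \<tau> \<le> ts k\<close>, so the instants escape to
  infinity and finitely many pieces cover any bounded interval. On each piece the integrand is
  constant except possibly at the right end point.\<close>

lemma switching_signal_integrable:
  fixes f :: "nat \<Rightarrow> real"
  assumes sig: "switching_signal p \<tau> ts \<sigma>" and a: "0 \<le> a"
  shows "(\<lambda>s. f (\<sigma> s)) integrable_on {a..b}"
proof -
  have \<tau>: "0 < \<tau>" "0 \<le> ts 0" "\<tau> \<le> ts (Suc k) - ts k"
    and init: "t \<in> {0..<ts 0} \<Longrightarrow> \<sigma> t = \<sigma> 0"
    and const: "t \<in> {ts k..<ts (Suc k)} \<Longrightarrow> \<sigma> t = \<sigma> (ts k)" for k t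
    using sig unfolding switching_signal_def by blast+
  have piece: "(\<lambda>s. f (\<sigma> s)) integrable_on {u..v}" if "\<And>t. u \<le> t \<Longrightarrow> t < v \<Longrightarrow> \<sigma> t = r" for u v r
    by (rule integrable_spike_finite[of "{v}" _ _ "\<lambda>_. f r"]) (use that in auto)
  have ge: "real k * \<tau> \<le> ts k" for k
  proof (induction k)
    case (Suc k)
    then show ?case
      using \<tau>(3)[of k] by (simp add: algebra_simps)
  qed (use \<tau> in simp)
  have all: "(\<lambda>s. f (\<sigma> s)) integrable_on {0..ts k}" for k
  proof (induction k)
    case 0
    show ?case
      by (rule piece[of _ _ "\<sigma> 0"]) (rule init, simp)
  next
    case (Suc k)
    have "(\<lambda>s. f (\<sigma> s)) integrable_on {ts k..ts (Suc k)}"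
      by (rule piece[of _ _ "\<sigma> (ts k)"]) (rule const, simp)
    moreover have "0 \<le> ts k"
      using ge[of k] \<tau>(1) by (meson mult_nonneg_nonneg of_nat_0_le_iff order_trans less_imp_le)
    ultimately show ?case
      using Suc \<tau>(1) \<tau>(3)[of k]
      by (auto intro: Henstock_Kurzweil_Integration.integrable_combine[where c = "ts k"])
  qed
  obtain k where "b < real k * \<tau>"
    using ex_less_of_nat_mult[OF \<tau>(1)] by blast
  then have "b \<le> ts k"
    using ge[of k] by linarith
  then show ?thesis
    using a by (intro integrable_on_subinterval[OF all[of k]]) auto
qed

section \<open>Laplacians of strongly connected graphs\<close>

text \<open>Induction along a directed walk from \<open>u\<close> to \<open>v\<close>. The edge
  belonging to \<open>W $$ (i, j)\<close> leads from \<open>j\<close> to \<open>i\<close>, which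
  fixes the direction of \<open>step\<close>. The lemma is applied to the zeros of a left null
  vector and to the agreement of blocks.\<close>

lemma strongly_connected_propagate:
  assumes sc: "strongly_connected (with_proj (graph_of N W))"
    and u: "u < N" "Q u" and v: "v < N"
    and step: "\<And>i j. i < N \<Longrightarrow> j < N \<Longrightarrow> 0 < W $$ (i, j) \<Longrightarrow> Q j \<Longrightarrow> Q i"
  shows "Q v"
proof -
  let ?G = "with_proj (graph_of N W)"
  have "(u, v) \<in> rtrancl_on (verts ?G) (arcs_ends ?G)"
    using sc u v by (auto simp: strongly_connected_def reachable_def graph_of_def)
  then show ?thesis
  proof (induction rule: rtrancl_on_induct)
    case base
    show ?case by (rule u)
  next
    case (step x y)
    then have "(x, y) \<in> parcs (graph_of N W)"
      by (auto simp: arcs_ends_def arc_to_ends_def)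
    then show ?case
      using assms(5) step by (auto simp: graph_of_def)
  qed
qed

lemma laplacian_carrier [simp]: "laplacian N W \<in> carrier_mat N N"
  by (simp add: laplacian_def)

lemma laplacian_index:
  assumes "weighted_graph N W" "i < N" "j < N"
  shows "laplacian N W $$ (i, j) = (if i = j then \<Sum>k<N. W $$ (i, k) else 0) - W $$ (i, j)"
  using assms by (simp add: laplacian_def weighted_graph_def)

lemma sum_mult_laplacian:
  assumes W: "weighted_graph N W" and j: "j < N"
  shows "(\<Sum>i<N. y i * laplacian N W $$ (i, j)) = y j * (\<Sum>k<N. W $$ (j, k)) - (\<Sum>i<N. y i * W $$ (i, j))"
proof -
  have "(\<Sum>i<N. y i * laplacian N W $$ (i, j)) =
    (\<Sum>i<N. (if j = i then y i * (\<Sum>k<N. W $$ (i, k)) else 0) - y i * W $$ (i, j))"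
    by (intro sum.cong) (auto simp: laplacian_index[OF W _ j] algebra_simps)
  then show ?thesis
    using j by (simp add: sum_subtractf sum.delta)
qed

lemma laplacian_row_mult:
  assumes W: "weighted_graph N W" and i: "i < N"
  shows "(\<Sum>j<N. laplacian N W $$ (i, j) * y j) = (\<Sum>j<N. W $$ (i, j) * (y i - y j))"
proof -
  have "(\<Sum>j<N. laplacian N W $$ (i, j) * y j) =
    (\<Sum>j<N. (if i = j then (\<Sum>k<N. W $$ (i, k)) * y j else 0) - W $$ (i, j) * y j)"
    by (intro sum.cong) (auto simp: laplacian_index[OF W i] algebra_simps)
  then show ?thesis
    using i by (simp add: sum_subtractf sum.delta right_diff_distrib sum_distrib_right)
qed

text \<open>The rows of the Laplacian sum to zero, so it is singular and has a left null vector
  \<open>y\<close>. Signs are removed by passing to absolute values, which form a null vector again;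
  a zero among them would spread along the edges to every vertex, so strong connectivity makes all
  of them positive.\<close>

lemma laplacian_positive_left_null:
  assumes W: "weighted_graph N W" and sc: "strongly_connected (with_proj (graph_of N W))"
  obtains \<theta> :: "nat \<Rightarrow> real" where "\<And>i. i < N \<Longrightarrow> 0 < \<theta> i"
    "\<And>j. j < N \<Longrightarrow> (\<Sum>i<N. \<theta> i * laplacian N W $$ (i, j)) = 0"
proof -
  let ?L = "laplacian N W" and ?one = "vec N (\<lambda>_. 1) :: real vec"
  have Wn: "0 \<le> W $$ (i, j)" if "i < N" "j < N" for i j
    using W that by (simp add: weighted_graph_def)
  have N: "0 < N"
    using sc by (auto simp: strongly_connected_def graph_of_def)
  have "?L *\<^sub>v ?one = 0\<^sub>v N"
    using laplacian_row_mult[OF W, of _ "\<lambda>_. 1"]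
    by (intro eq_vecI)
      (simp_all add: mult_mat_vec_index[OF laplacian_carrier] carrier_matD[OF laplacian_carrier]
        del: index_mult_mat_vec)
  moreover have "?one \<noteq> 0\<^sub>v N"
    using N by (metis index_vec index_zero_vec(1) zero_neq_one)
  ultimately have "det ?L = 0"
    using det_0_iff_vec_prod_zero_field[of ?L N] laplacian_carrier vec_carrier by blast
  then have "det (transpose_mat ?L) = 0"
    by (simp add: det_transpose[of _ N])
  then obtain v where v: "v \<in> carrier_vec N" "v \<noteq> 0\<^sub>v N" "transpose_mat ?L *\<^sub>v v = 0\<^sub>v N"
    using det_0_iff_vec_prod_zero_field[OF transpose_carrier_mat[THEN iffD2, OF laplacian_carrier]] by blast
  define y where "y i = v $ i" for i
  have null: "(\<Sum>i<N. y i * ?L $$ (i, j)) = 0" if "j < N" for j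
  proof -
    have "(transpose_mat ?L *\<^sub>v v) $ j = (\<Sum>i<N. transpose_mat ?L $$ (j, i) * v $ i)"
      using that v(1) by (intro mult_mat_vec_index[of _ N]) auto
    also have "\<dots> = (\<Sum>i<N. ?L $$ (i, j) * v $ i)"
      using that by (intro sum.cong) (auto simp: laplacian_def)
    finally have "(transpose_mat ?L *\<^sub>v v) $ j = (\<Sum>i<N. ?L $$ (i, j) * v $ i)" .
    then show ?thesis
      using v that by (simp add: y_def mult.commute)
  qed
  \<comment> \<open>The inequalities below have equal totals over \<open>j\<close>, so each is an equality and \<open>\<bar>y\<bar>\<close> is again a null vector.\<close>
  have le: "\<bar>y j\<bar> * (\<Sum>k<N. W $$ (j, k)) \<le> (\<Sum>i<N. \<bar>y i\<bar> * W $$ (i, j))" if j: "j < N" for j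
  proof -
    have "0 \<le> (\<Sum>k<N. W $$ (j, k))"
      using j by (intro sum_nonneg Wn) auto
    then have "\<bar>y j\<bar> * (\<Sum>k<N. W $$ (j, k)) = \<bar>y j * (\<Sum>k<N. W $$ (j, k))\<bar>"
      by (simp only: abs_mult abs_of_nonneg)
    also have "\<dots> = \<bar>\<Sum>i<N. y i * W $$ (i, j)\<bar>"
      using null[OF j] sum_mult_laplacian[OF W j, of y] by simp
    also have "\<dots> \<le> (\<Sum>i<N. \<bar>y i * W $$ (i, j)\<bar>)"
      by (rule sum_abs)
    also have "\<dots> = (\<Sum>i<N. \<bar>y i\<bar> * W $$ (i, j))"
      using j by (intro sum.cong) (auto simp: abs_mult Wn)
    finally show ?thesis .
  qed
  have total: "(\<Sum>j<N. \<bar>y j\<bar> * (\<Sum>k<N. W $$ (j, k))) = (\<Sum>j<N. \<Sum>i<N. \<bar>y i\<bar> * W $$ (i, j))"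
    unfolding sum_distrib_left by (rule sum.swap)
  have eq: "\<bar>y j\<bar> * (\<Sum>k<N. W $$ (j, k)) = (\<Sum>i<N. \<bar>y i\<bar> * W $$ (i, j))" if "j < N" for j
    by (rule sum_mono_inv[OF total]) (use le that in auto)
  have nz: "y i \<noteq> 0" if i: "i < N" for i
  proof
    assume "y i = 0"
    have "y k = 0" if "k < N" for k
    proof (rule strongly_connected_propagate[where Q = "\<lambda>i. y i = 0", OF sc i \<open>y i = 0\<close> that])
      fix l j
      assume l: "l < N" "j < N" "0 < W $$ (l, j)" "y j = 0"
      then have "(\<Sum>i<N. \<bar>y i\<bar> * W $$ (i, j)) = 0"
        using eq[OF l(2)] by simp
      then have "\<bar>y l\<bar> * W $$ (l, j) = 0"
        using l Wn by (subst (asm) sum_nonneg_eq_0_iff) auto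
      then show "y l = 0"
        using l by simp
    qed
    then have "v = 0\<^sub>v N"
      using v(1) by (intro eq_vecI) (auto simp: y_def)
    then show False
      using v(2) by simp
  qed
  show thesis
    by (rule that[of "\<lambda>i. \<bar>y i\<bar>"]) (use nz eq sum_mult_laplacian[OF W] in auto)
qed

text \<open>The left null vector supplies what symmetry gives for an undirected graph: the sum of
  \<open>\<theta> k * W $$ (k, l) * ((y k)\<^sup>2 - (y l)\<^sup>2)\<close> vanishes. Subtracting
  half of it completes the squares, because \<open>a * (a - b) - (a\<^sup>2 - b\<^sup>2) / 2 = (a -
  b)\<^sup>2 / 2\<close>.\<close>

lemma laplacian_weighted_quadratic:
  assumes W: "weighted_graph N W"
    and null: "\<And>j. j < N \<Longrightarrow> (\<Sum>i<N. \<theta> i * laplacian N W $$ (i, j)) = 0"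
  shows "(\<Sum>k<N. \<Sum>l<N. \<theta> k * laplacian N W $$ (k, l) * (y k * y l)) =
    (\<Sum>k<N. \<Sum>l<N. \<theta> k * W $$ (k, l) / 2 * (y k - y l)\<^sup>2)"
proof -
  have "0 = (\<Sum>l<N. (\<Sum>k<N. \<theta> k * laplacian N W $$ (k, l)) * (y l)\<^sup>2)"
    using null by simp
  also have "\<dots> = (\<Sum>l<N. \<Sum>k<N. \<theta> k * (laplacian N W $$ (k, l) * (y l)\<^sup>2))"
    by (simp add: sum_distrib_right mult.assoc)
  also have "\<dots> = (\<Sum>k<N. \<theta> k * (\<Sum>l<N. laplacian N W $$ (k, l) * (y l)\<^sup>2))"
    by (subst sum.swap) (simp add: sum_distrib_left)
  also have "\<dots> = (\<Sum>k<N. \<theta> k * (\<Sum>l<N. W $$ (k, l) * ((y k)\<^sup>2 - (y l)\<^sup>2)))"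
    by (intro sum.cong refl) (simp add: laplacian_row_mult[OF W, of _ "\<lambda>l. (y l)\<^sup>2"])
  finally have zero: "(\<Sum>k<N. \<theta> k * (\<Sum>l<N. W $$ (k, l) * ((y k)\<^sup>2 - (y l)\<^sup>2))) = 0"
    by simp
  have "(\<Sum>k<N. \<Sum>l<N. \<theta> k * laplacian N W $$ (k, l) * (y k * y l)) =
    (\<Sum>k<N. \<theta> k * y k * (\<Sum>l<N. laplacian N W $$ (k, l) * y l))"
    by (simp add: sum_distrib_left mult_ac)
  also have "\<dots> = (\<Sum>k<N. \<theta> k * y k * (\<Sum>l<N. W $$ (k, l) * (y k - y l)))"
    by (intro sum.cong refl) (simp add: laplacian_row_mult[OF W])
  also have "\<dots> = (\<Sum>k<N. \<theta> k * y k * (\<Sum>l<N. W $$ (k, l) * (y k - y l)))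
      - (\<Sum>k<N. \<theta> k * (\<Sum>l<N. W $$ (k, l) * ((y k)\<^sup>2 - (y l)\<^sup>2))) / 2"
    using zero by simp
  also have "\<dots> = (\<Sum>k<N. \<Sum>l<N. \<theta> k * W $$ (k, l) / 2 * (y k - y l)\<^sup>2)"
    unfolding sum_distrib_left sum_divide_distrib sum_subtractf[symmetric]
    by (intro sum.cong refl) (simp add: power2_eq_square field_simps)
  finally show ?thesis .
qed

text \<open>Positive definiteness of a sum of squares is turned into a lower bound by linear algebra
  and Cauchy-Schwarz, in place of a compactness argument on the unit sphere.\<close>

lemma inj_linear_forms_coercive:
  fixes l :: "'i \<Rightarrow> nat \<Rightarrow> real"
  assumes I: "finite I"
    and inj: "\<And>x. \<forall>a\<in>I. (\<Sum>k<d. l a k * x k) = 0 \<Longrightarrow> \<forall>k<d. x k = 0"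
  shows "\<exists>\<mu>>0. \<forall>x. \<mu> * (\<Sum>k<d. (x k)\<^sup>2) \<le> (\<Sum>a\<in>I. (\<Sum>k<d. l a k * x k)\<^sup>2)"
proof -
  \<comment> \<open>The Gram matrix of the forms is invertible, so \<open>x\<close> is a linear function of the values of the forms.\<close>
  define B where "B = mat d d (\<lambda>(i, j). \<Sum>a\<in>I. l a i * l a j)"
  have B: "B \<in> carrier_mat d d"
    by (simp add: B_def)
  have Bx: "(\<Sum>j<d. B $$ (i, j) * x j) = (\<Sum>a\<in>I. l a i * (\<Sum>k<d. l a k * x k))" if "i < d" for i x
    using that by (simp add: B_def sum_distrib_left sum_distrib_right mult_ac sum.swap[of _ I])
  \<comment> \<open>For a null vector \<open>v\<close> of the Gram matrix,
    \<open>v\<^sup>T B v = 0\<close> is the sum of the squares of the forms at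
    \<open>v\<close>.\<close>
  have "det B \<noteq> 0"
  proof
    assume "det B = 0"
    then obtain v where v: "v \<in> carrier_vec d" "v \<noteq> 0\<^sub>v d" "B *\<^sub>v v = 0\<^sub>v d"
      using det_0_iff_vec_prod_zero_field[OF B] by blast
    have "(\<Sum>j<d. B $$ (i, j) * v $ j) = 0" if "i < d" for i
    proof -
      have "(B *\<^sub>v v) $ i = (\<Sum>j<d. B $$ (i, j) * v $ j)"
        using that v B by (intro mult_mat_vec_index)
      then show ?thesis
        unfolding v(3) using that by simp
    qed
    define S where "S a = (\<Sum>k<d. l a k * v $ k)" for a
    have "0 = (\<Sum>i<d. v $ i * (\<Sum>j<d. B $$ (i, j) * v $ j))"
      using \<open>\<And>i. i < d \<Longrightarrow> (\<Sum>j<d. B $$ (i, j) * v $ j) = 0\<close> by simp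
    also have "\<dots> = (\<Sum>i<d. \<Sum>a\<in>I. v $ i * (l a i * S a))"
      by (simp add: Bx S_def[symmetric] sum_distrib_left)
    also have "\<dots> = (\<Sum>a\<in>I. (\<Sum>i<d. l a i * v $ i) * S a)"
      unfolding sum_distrib_right by (subst sum.swap) (simp add: mult_ac)
    finally have "(\<Sum>a\<in>I. (S a)\<^sup>2) = 0"
      by (simp add: S_def[symmetric] power2_eq_square)
    then have "\<forall>a\<in>I. (\<Sum>k<d. l a k * v $ k) = 0"
      using I by (simp add: sum_nonneg_eq_0_iff S_def)
    then have "v = 0\<^sub>v d"
      using inj[of "\<lambda>k. v $ k"] v(1) by (intro eq_vecI) auto
    then show False
      using v(2) by simp
  qed
  then obtain G where G: "G \<in> carrier_mat d d" "G * B = 1\<^sub>m d"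
    using det_non_zero_imp_unit[OF B, of "()"] by (auto simp: Units_def ring_mat_def)
  define H where "H k a = (\<Sum>i<d. G $$ (k, i) * l a i)" for k a
  have x_eq: "x k = (\<Sum>a\<in>I. H k a * (\<Sum>j<d. l a j * x j))" if k: "k < d" for k x
  proof -
    have GB: "(\<Sum>i<d. G $$ (k, i) * B $$ (i, j)) = (if k = j then 1 else 0)" if "j < d" for j
      using mult_mat_index[OF G(1) B k that] k that by (simp add: G(2))
    have "x k = (\<Sum>j<d. if k = j then x j else 0)"
      using k by simp
    also have "\<dots> = (\<Sum>j<d. (\<Sum>i<d. G $$ (k, i) * B $$ (i, j)) * x j)"
      by (intro sum.cong) (auto simp: GB)
    also have "\<dots> = (\<Sum>i<d. G $$ (k, i) * (\<Sum>j<d. B $$ (i, j) * x j))"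
      unfolding sum_distrib_left sum_distrib_right by (subst sum.swap) (simp add: mult_ac)
    also have "\<dots> = (\<Sum>i<d. \<Sum>a\<in>I. G $$ (k, i) * (l a i * (\<Sum>j<d. l a j * x j)))"
      by (simp add: Bx sum_distrib_left)
    also have "\<dots> = (\<Sum>a\<in>I. H k a * (\<Sum>j<d. l a j * x j))"
      unfolding H_def sum_distrib_right[of _ "{..<d}" "\<Sum>j<d. _ j"]
      by (subst sum.swap) (simp add: mult_ac)
    finally show ?thesis .
  qed
  \<comment> \<open>The squared Frobenius norm of the coefficients \<open>H\<close>. It may be zero,
    hence the divisor \<open>C + 1\<close> below.\<close>
  define C where "C = (\<Sum>k<d. \<Sum>a\<in>I. (H k a)\<^sup>2)"
  have C: "0 \<le> C"
    by (simp add: C_def sum_nonneg)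
  have "(\<Sum>k<d. (x k)\<^sup>2) \<le> C * (\<Sum>a\<in>I. (\<Sum>k<d. l a k * x k)\<^sup>2)" for x
  proof -
    have "(x k)\<^sup>2 \<le> (\<Sum>a\<in>I. (H k a)\<^sup>2) * (\<Sum>a\<in>I. (\<Sum>k<d. l a k * x k)\<^sup>2)" if "k < d" for k
      using Cauchy_Schwarz_ineq_sum[of "H k" "\<lambda>a. \<Sum>j<d. l a j * x j" I] x_eq[OF that, of x] by simp
    then show ?thesis
      unfolding C_def sum_distrib_right by (intro sum_mono) auto
  qed
  then have "1 / (C + 1) * (\<Sum>k<d. (x k)\<^sup>2) \<le> (\<Sum>a\<in>I. (\<Sum>k<d. l a k * x k)\<^sup>2)" for x
  proof -
    assume *: "\<And>x. (\<Sum>k<d. (x k)\<^sup>2) \<le> C * (\<Sum>a\<in>I. (\<Sum>k<d. l a k * x k)\<^sup>2)"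
    have "(\<Sum>k<d. (x k)\<^sup>2) \<le> (C + 1) * (\<Sum>a\<in>I. (\<Sum>k<d. l a k * x k)\<^sup>2)"
      using *[of x] sum_nonneg[of I "\<lambda>a. (\<Sum>k<d. l a k * x k)\<^sup>2"] by (simp add: distrib_right)
    then show ?thesis
      using C by (simp add: field_simps)
  qed
  then show ?thesis
    using C by (intro exI[of _ "1 / (C + 1)"]) auto
qed

section \<open>The coupled error system\<close>

lemma orthonormal_kernel_basis_mult_eq_0:
  assumes M: "M \<in> carrier_mat m n" and V: "orthonormal_kernel_basis n M V"
    and x: "x \<in> carrier_vec (dim_col V)"
  shows "M *\<^sub>v (V *\<^sub>v x) = 0\<^sub>v m"
proof -
  have Vc: "V \<in> carrier_mat n (dim_col V)"
    using V by (auto simp: orthonormal_kernel_basis_def)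
  interpret kernel m n M
    by (rule kernel.intro[OF M])
  have cols: "set (cols V) \<subseteq> mat_kernel M"
    using V unfolding orthonormal_kernel_basis_def Ker.basis_def by blast
  have "M * V = 0\<^sub>m m (dim_col V)"
  proof (rule eq_matI)
    fix i j
    assume ij: "i < dim_row (0\<^sub>m m (dim_col V) :: real mat)" "j < dim_col (0\<^sub>m m (dim_col V) :: real mat)"
    then have "col V j \<in> mat_kernel M"
      using cols by (auto simp: cols_def)
    then have "(M *\<^sub>v col V j) $ i = 0"
      using mat_kernelD(2)[OF M] ij by simp
    then show "(M * V) $$ (i, j) = 0\<^sub>m m (dim_col V) $$ (i, j)"
      using ij M by simp
  qed (use M in auto)
  moreover have "0\<^sub>m m (dim_col V) *\<^sub>v x = 0\<^sub>v m"
    using x by (intro eq_vecI) (auto simp: scalar_prod_def)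
  ultimately have "(M * V) *\<^sub>v x = 0\<^sub>v m"
    by simp
  then show ?thesis
    using assoc_mult_mat_vec[OF M Vc x] by simp
qed

text \<open>Orthonormality makes the transpose of \<open>V\<close> a left inverse of
  \<open>V\<close>.\<close>

lemma orthonormal_kernel_basis_inj:
  assumes V: "orthonormal_kernel_basis n M V"
    and Vx: "\<And>r. r < n \<Longrightarrow> (\<Sum>c<dim_col V. V $$ (r, c) * x c) = 0" and c: "c < dim_col V"
  shows "x c = 0"
proof -
  have Vr: "dim_row V = n"
    using V by (auto simp: orthonormal_kernel_basis_def)
  have on: "(\<Sum>r<n. V $$ (r, c) * V $$ (r, c')) = (if c = c' then 1 else 0)" if "c' < dim_col V" for c'
  proof -
    have "col V c \<bullet> col V c' = (\<Sum>r<n. V $$ (r, c) * V $$ (r, c'))"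
      using that c by (auto simp: Vr scalar_prod_def atLeast0LessThan intro!: sum.cong)
    then show ?thesis
      using V that c unfolding orthonormal_kernel_basis_def by metis
  qed
  have "x c = (\<Sum>c'<dim_col V. if c = c' then x c' else 0)"
    using c by simp
  also have "\<dots> = (\<Sum>c'<dim_col V. (\<Sum>r<n. V $$ (r, c) * V $$ (r, c')) * x c')"
    by (intro sum.cong) (auto simp: on)
  also have "\<dots> = (\<Sum>r<n. V $$ (r, c) * (\<Sum>c'<dim_col V. V $$ (r, c') * x c'))"
    unfolding sum_distrib_left sum_distrib_right by (subst sum.swap) (simp add: mult_ac)
  also have "\<dots> = 0"
    using Vx by simp
  finally show ?thesis .
qed

text \<open>In the application \<open>U k r j\<close> is the entry of \<open>Vu\<close> in row
  \<open>r\<close> of block row \<open>k\<close>, and \<open>\<beta> j\<close> is the block of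
  column \<open>j\<close>. By \<open>supp\<close> the weights \<open>\<theta> (\<beta> i)\<close>
  pass through the transpose of \<open>Vu\<close> and become weights on the vertices, so
  \<open>laplacian_weighted_quadratic\<close> applies in each component \<open>r\<close>. Hypothesis
  \<open>inj\<close> lets agreement of the blocks force \<open>x\<close> to vanish.\<close>

lemma coupling_coercive:
  fixes U :: "nat \<Rightarrow> nat \<Rightarrow> nat \<Rightarrow> real"
  assumes W: "weighted_graph N W" and sc: "strongly_connected (with_proj (graph_of N W))"
    and \<theta>: "\<And>i. i < N \<Longrightarrow> 0 < \<theta> i"
    and null: "\<And>j. j < N \<Longrightarrow> (\<Sum>i<N. \<theta> i * laplacian N W $$ (i, j)) = 0"
    and supp: "\<And>k r j. k < N \<Longrightarrow> r < n \<Longrightarrow> j < d \<Longrightarrow> k \<noteq> \<beta> j \<Longrightarrow> U k r j = 0"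
    and inj: "\<And>x y. (\<And>k r. k < N \<Longrightarrow> r < n \<Longrightarrow> (\<Sum>j<d. U k r j * x j) = y r) \<Longrightarrow> \<forall>j<d. x j = 0"
  shows "\<exists>\<mu>>0. \<forall>x. \<mu> * (\<Sum>j<d. (x j)\<^sup>2) \<le> (\<Sum>i<d. \<theta> (\<beta> i) * x i *
    (\<Sum>j<d. (\<Sum>k<N. \<Sum>l<N. laplacian N W $$ (k, l) * (\<Sum>r<n. U k r i * U l r j)) * x j))"
proof -
  let ?L = "laplacian N W"
  define Y where "Y x k r = (\<Sum>j<d. U k r j * x j)" for x k r
  have Wn: "0 \<le> W $$ (k, l)" if "k < N" "l < N" for k l
    using W that by (simp add: weighted_graph_def)
  define I where "I = {..<n} \<times> {..<N} \<times> {..<N}"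
  \<comment> \<open>Differences across edges, scaled so that their squares add up to the weighted
    Laplacian form; the factor is zero where there is no edge.\<close>
  define f where "f = (\<lambda>(r, k, l) j. sqrt (\<theta> k * W $$ (k, l) / 2) * (U k r j - U l r j))"
  have f_sum: "(\<Sum>j<d. f (r, k, l) j * x j) = sqrt (\<theta> k * W $$ (k, l) / 2) * (Y x k r - Y x l r)"
    for r k l x
    unfolding f_def Y_def prod.case sum_subtractf[symmetric] sum_distrib_left
    by (intro sum.cong) (auto simp: algebra_simps)
  have "\<exists>\<mu>>0. \<forall>x. \<mu> * (\<Sum>k<d. (x k)\<^sup>2) \<le> (\<Sum>a\<in>I. (\<Sum>k<d. f a k * x k)\<^sup>2)"
  proof (rule inj_linear_forms_coercive)
    show "finite I"
      by (simp add: I_def)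
    fix x
    assume zero: "\<forall>a\<in>I. (\<Sum>k<d. f a k * x k) = 0"
    have edge: "Y x k r = Y x l r" if "k < N" "l < N" "0 < W $$ (k, l)" "r < n" for k l r
    proof -
      have "(\<Sum>j<d. f (r, k, l) j * x j) = 0"
        using zero that by (auto simp: I_def)
      then show ?thesis
        using that \<theta>[of k] by (simp add: f_sum)
    qed
    \<comment> \<open>Agreement along edges reaches every vertex from the reference vertex
      \<open>0\<close>; the common value is then independent of \<open>k\<close>, as
      \<open>inj\<close> demands.\<close>
    have "Y x k r = Y x 0 r" if "k < N" "r < n" for k r
      by (rule strongly_connected_propagate[where Q = "\<lambda>k. Y x k r = Y x 0 r", OF sc _ _ that(1)])
        (use edge that in auto)
    then show "\<forall>k<d. x k = 0"
      unfolding Y_def by (rule inj)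
  qed
  then obtain \<mu> where \<mu>: "0 < \<mu>"
    and coercive: "\<And>x. \<mu> * (\<Sum>k<d. (x k)\<^sup>2) \<le> (\<Sum>a\<in>I. (\<Sum>k<d. f a k * x k)\<^sup>2)"
    by blast
  have "(\<Sum>a\<in>I. (\<Sum>k<d. f a k * x k)\<^sup>2) = (\<Sum>i<d. \<theta> (\<beta> i) * x i *
    (\<Sum>j<d. (\<Sum>k<N. \<Sum>l<N. ?L $$ (k, l) * (\<Sum>r<n. U k r i * U l r j)) * x j))" for x
  proof -
    have inner: "(\<Sum>j<d. (\<Sum>k<N. \<Sum>l<N. ?L $$ (k, l) * (\<Sum>r<n. U k r i * U l r j)) * x j) =
        (\<Sum>k<N. \<Sum>l<N. \<Sum>r<n. U k r i * (?L $$ (k, l) * Y x l r))" for i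
      unfolding Y_def sum_distrib_left sum_distrib_right sum.swap[of _ _ "{..<d}"]
      by (simp add: mult_ac)
    have weight: "(\<Sum>i<d. \<theta> (\<beta> i) * x i * U k r i) = \<theta> k * Y x k r" if "k < N" "r < n" for k r
      unfolding Y_def sum_distrib_left
    proof (rule sum.cong[OF refl])
      fix i
      assume "i \<in> {..<d}"
      then show "\<theta> (\<beta> i) * x i * U k r i = \<theta> k * (U k r i * x i)"
        using supp[OF that, of i] by (cases "k = \<beta> i") auto
    qed
    have "(\<Sum>i<d. \<theta> (\<beta> i) * x i *
        (\<Sum>j<d. (\<Sum>k<N. \<Sum>l<N. ?L $$ (k, l) * (\<Sum>r<n. U k r i * U l r j)) * x j)) =
      (\<Sum>k<N. \<Sum>l<N. \<Sum>r<n. (\<Sum>i<d. \<theta> (\<beta> i) * x i * U k r i) * (?L $$ (k, l) * Y x l r))"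
      unfolding inner unfolding sum_distrib_left sum_distrib_right sum.swap[of _ _ "{..<d}"]
      by (simp add: mult_ac)
    also have "\<dots> = (\<Sum>k<N. \<Sum>l<N. \<Sum>r<n. \<theta> k * ?L $$ (k, l) * (Y x k r * Y x l r))"
      by (intro sum.cong refl) (simp add: weight)
    also have "\<dots> = (\<Sum>r<n. \<Sum>k<N. \<Sum>l<N. \<theta> k * ?L $$ (k, l) * (Y x k r * Y x l r))"
      unfolding sum.swap[of _ "{..<n}"] ..
    also have "\<dots> = (\<Sum>r<n. \<Sum>k<N. \<Sum>l<N. \<theta> k * W $$ (k, l) / 2 * (Y x k r - Y x l r)\<^sup>2)"
      by (simp only: laplacian_weighted_quadratic[OF W null])
    also have "\<dots> = (\<Sum>r<n. \<Sum>k<N. \<Sum>l<N. (\<Sum>j<d. f (r, k, l) j * x j)\<^sup>2)"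
      using \<theta> Wn by (intro sum.cong refl) (simp add: f_sum power_mult_distrib less_imp_le)
    also have "\<dots> = (\<Sum>a\<in>I. (\<Sum>k<d. f a k * x k)\<^sup>2)"
      by (simp add: I_def sum.cartesian_product)
    finally show ?thesis ..
  qed
  with \<mu> coercive show ?thesis
    by auto
qed

text \<open>The factor \<open>1\<^sub>m n\<close> couples only equal components of two blocks, which
  leaves one sum over \<open>r\<close> instead of two.\<close>

lemma mult_kronecker_one_mult_index:
  assumes V: "V \<in> carrier_mat (N * n) d" and L: "L \<in> carrier_mat N N" and ij: "i < d" "j < d"
  shows "(transpose_mat V * kronecker L (1\<^sub>m n) * V) $$ (i, j) =
    (\<Sum>k<N. \<Sum>l<N. L $$ (k, l) * (\<Sum>r<n. V $$ (k * n + r, i) * V $$ (l * n + r, j)))"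
proof -
  let ?K = "kronecker L (1\<^sub>m n)"
  have K: "?K \<in> carrier_mat (N * n) (N * n)"
    using L by (simp add: kronecker_def)
  have blocks: "(\<Sum>a<N * n. g a) = (\<Sum>k<N. \<Sum>r<n. g (k * n + r))" for g :: "nat \<Rightarrow> real"
    using sum_concat_blocks[of g "\<lambda>_. n" N] by simp
  have less: "k * n + r < N * n" if "k < N" "r < n" for k r
  proof -
    have "k * n + r < Suc k * n"
      using that by simp
    also have "\<dots> \<le> N * n"
      using that by (intro mult_le_mono1) simp
    finally show ?thesis .
  qed
  have K_index: "?K $$ (k * n + r, l * n + s) = (if r = s then L $$ (k, l) else 0)"
    if "k < N" "r < n" "l < N" "s < n" for k r l s
    using that less[of k r] less[of l s] L by (simp add: kronecker_def)
  have VT: "transpose_mat V \<in> carrier_mat d (N * n)"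
    using V by simp
  have "(transpose_mat V * ?K * V) $$ (i, j) = (\<Sum>b<N * n. (transpose_mat V * ?K) $$ (i, b) * V $$ (b, j))"
    by (rule mult_mat_index[OF mult_carrier_mat[OF VT K] V ij])
  also have "\<dots> = (\<Sum>b<N * n. (\<Sum>a<N * n. V $$ (a, i) * ?K $$ (a, b)) * V $$ (b, j))"
    using V ij by (intro sum.cong refl) (simp add: mult_mat_index[OF VT K] del: index_mult_mat)
  also have "\<dots> = (\<Sum>l<N. \<Sum>s<n. (\<Sum>k<N. \<Sum>r<n. V $$ (k * n + r, i) * (if r = s then L $$ (k, l) else 0)) *
      V $$ (l * n + s, j))"
    unfolding blocks by (intro sum.cong refl) (simp add: K_index)
  also have "\<dots> = (\<Sum>l<N. \<Sum>s<n. (\<Sum>k<N. V $$ (k * n + s, i) * L $$ (k, l)) * V $$ (l * n + s, j))"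
    by (intro sum.cong refl) (simp add: if_distrib sum.delta cong: if_cong)
  also have "\<dots> = (\<Sum>k<N. \<Sum>l<N. L $$ (k, l) * (\<Sum>s<n. V $$ (k * n + s, i) * V $$ (l * n + s, j)))"
    unfolding sum_distrib_left sum_distrib_right sum.swap[of _ "{..<N}" "{..<n}"]
    by (subst sum.swap) (simp add: mult_ac)
  finally show ?thesis .
qed

text \<open>A crude bound suffices: it is applied to the drift \<open>Au\<close>, which a large
  \<open>\<gamma>\<close> dominates.\<close>

lemma quadratic_form_le:
  fixes a :: "nat \<Rightarrow> nat \<Rightarrow> real"
  shows "(\<Sum>i<d. x i * (\<Sum>j<d. a i j * x j)) \<le> (\<Sum>i<d. \<Sum>j<d. \<bar>a i j\<bar>) * (\<Sum>i<d. (x i)\<^sup>2)"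
proof -
  define X where "X = (\<Sum>i<d. (x i)\<^sup>2)"
  have sq: "(x k)\<^sup>2 \<le> X" if "k < d" for k
    unfolding X_def using that by (intro member_le_sum) auto
  have "x i * (a i j * x j) \<le> \<bar>a i j\<bar> * X" if "i < d" "j < d" for i j
  proof -
    have "2 * \<bar>x i * x j\<bar> \<le> (x i)\<^sup>2 + (x j)\<^sup>2"
      using zero_le_power2[of "\<bar>x i\<bar> - \<bar>x j\<bar>"] by (simp add: power2_diff abs_mult)
    also have "\<dots> \<le> X + X"
      using that by (intro add_mono sq)
    finally have "\<bar>a i j\<bar> * \<bar>x i * x j\<bar> \<le> \<bar>a i j\<bar> * X"
      by (intro mult_left_mono) auto
    then show ?thesis
      using abs_ge_self[of "x i * (a i j * x j)"] by (simp add: abs_mult mult_ac)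
  qed
  then show ?thesis
    unfolding X_def[symmetric] sum_distrib_right sum_distrib_left by (intro sum_mono) auto
qed

theorem lemma6:
  fixes n N p :: nat and q :: "nat \<Rightarrow> nat"
    and A :: "real mat" and C V :: "nat \<Rightarrow> real mat"
    and W :: "nat \<Rightarrow> real mat" and Wavg :: "real mat"
    and \<sigma> :: "real \<Rightarrow> nat" and ts :: "nat \<Rightarrow> real" and \<tau> :: real
    and Au Vu :: "real mat"
  assumes "A \<in> carrier_mat n n"
    and "\<And>i. i < N \<Longrightarrow> C i \<in> carrier_mat (q i) n"
    and "observable n (stack_rows n (map C [0..<N])) A"
    and "\<And>i. i < N \<Longrightarrow> orthonormal_kernel_basis n (obs_mat n (C i) A) (V i)"
    and "Vu = diag_block_mat (map V [0..<N])"
    and "Au = diag_block_mat (map (\<lambda>i. transpose_mat (V i) * A * V i) [0..<N])"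
    and "\<And>r. r \<in> {1..p} \<Longrightarrow> weighted_graph N (W r)"
    and "switching_signal p \<tau> ts \<sigma>"
    and "jointly_strongly_connected N W ts \<sigma>"
    and "uniformly_connected_on_average N W \<sigma> Wavg"
    and "strongly_connected (with_proj (graph_of N Wavg))"
  shows "\<exists>\<gamma>0>0. \<forall>\<gamma>>\<gamma>0. \<exists>\<epsilon>s>0. \<forall>\<epsilon>. 0 < \<epsilon> \<and> \<epsilon> < \<epsilon>s \<longrightarrow>
    ltv_exponentially_stable (dim_row Au)
      (\<lambda>t. Au - \<gamma> \<cdot>\<^sub>m (transpose_mat Vu
                 * kronecker (laplacian N (W (\<sigma> (t / \<epsilon>)))) (1\<^sub>m n) * Vu))"
proof -

  \<comment> \<open>Block coordinates of \<open>Vu\<close> and \<open>Au\<close>\<close>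
  note basis = assms(4)
  define d where "d i = dim_col (V i)" for i
  define off where "off i = (\<Sum>k<i. d k)" for i
  define D where "D = off N"
  have Vr: "dim_row (V i) = n" if "i < N" for i
    using basis[OF that] by (auto simp: orthonormal_kernel_basis_def)
  have rows: "(\<Sum>l<k. dim_row (map V [0..<N] ! l)) = k * n" if "k \<le> N" for k
    using that by (simp add: Vr)
  have cols: "(\<Sum>l<k. dim_col (map V [0..<N] ! l)) = off k" if "k \<le> N" for k
    using that by (simp add: off_def d_def)
  have Vu: "Vu \<in> carrier_mat (N * n) D"
  proof (rule carrier_matI)
    show "dim_row Vu = N * n"
      using rows[of N] unfolding assms(5) dim_diag_block_mat
      by (simp add: interv_sum_list_conv_sum_set_nat atLeast0LessThan Vr)
    show "dim_col Vu = D"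
      unfolding assms(5) dim_diag_block_mat
      by (simp add: interv_sum_list_conv_sum_set_nat atLeast0LessThan comp_def D_def off_def d_def)
  qed
  have Au: "Au \<in> carrier_mat D D"
    unfolding assms(6)
    by (intro carrier_matI)
      (simp_all add: dim_diag_block_mat interv_sum_list_conv_sum_set_nat atLeast0LessThan comp_def
        D_def off_def d_def)
  define U where "U k r j = Vu $$ (k * n + r, j)" for k r j
  have U_index: "U k r (off i + c) = (if k = i then V k $$ (r, c) else 0)"
    if "k < N" "r < n" "i < N" "c < d i" for k r i c
  proof -
    have "diag_block_mat (map V [0..<N]) $$ ((\<Sum>l<k. dim_row (map V [0..<N] ! l)) + r,
        (\<Sum>l<i. dim_col (map V [0..<N] ! l)) + c) = (if k = i then map V [0..<N] ! k $$ (r, c) else 0)"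
      by (rule diag_block_mat_index) (use that in \<open>simp_all add: Vr d_def\<close>)
    then show ?thesis
      using that unfolding rows[OF less_imp_le[OF that(1)]] cols[OF less_imp_le[OF that(3)]]
      by (simp add: U_def assms(5))
  qed
  \<comment> \<open>Each column of the block diagonal \<open>Vu\<close> is supported in one block of
    rows; \<open>\<beta>\<close> selects that block.\<close>
  have "\<forall>j<D. \<exists>i<N. \<forall>k<N. \<forall>r<n. k \<noteq> i \<longrightarrow> U k r j = 0"
  proof (intro allI impI)
    fix j
    assume "j < D"
    then obtain i c where ic: "i < N" "c < d i" "j = off i + c"
      using concat_blocks_index[of j d N] by (auto simp: D_def off_def)
    then have "\<forall>k<N. \<forall>r<n. k \<noteq> i \<longrightarrow> U k r j = 0"
      using U_index by simp
    with ic(1) show "\<exists>i<N. \<forall>k<N. \<forall>r<n. k \<noteq> i \<longrightarrow> U k r j = 0"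
      by blast
  qed
  then obtain \<beta> where \<beta>: "\<And>j. j < D \<Longrightarrow> \<beta> j < N"
    "\<And>k r j. k < N \<Longrightarrow> r < n \<Longrightarrow> j < D \<Longrightarrow> k \<noteq> \<beta> j \<Longrightarrow> U k r j = 0"
    by metis

  \<comment> \<open>Unobservable subspaces with trivial intersection\<close>
  have inj: "\<forall>j<D. x j = 0"
    if y: "\<And>k r. k < N \<Longrightarrow> r < n \<Longrightarrow> (\<Sum>j<D. U k r j * x j) = y r" for x y
  proof -
    have block: "(\<Sum>c<d k. V k $$ (r, c) * x (off k + c)) = y r" if k: "k < N" and r: "r < n" for k r
    proof -
      have "y r = (\<Sum>i<N. \<Sum>c<d i. U k r (off i + c) * x (off i + c))"
        using y[OF k r] sum_concat_blocks[of "\<lambda>j. U k r j * x j" d N] by (simp add: D_def off_def)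
      also have "\<dots> = (\<Sum>i<N. if k = i then \<Sum>c<d k. V k $$ (r, c) * x (off k + c) else 0)"
        using k r by (intro sum.cong) (auto simp: U_index)
      finally show ?thesis
        using k by simp
    qed
    \<comment> \<open>For every \<open>k\<close> the common value \<open>y\<close> is
      \<open>V k\<close> applied to the \<open>k\<close>-th part of \<open>x\<close>, so it lies in
      every unobservable subspace.\<close>
    have "vec n y = 0\<^sub>v n"
    proof (rule jointly_observable_eq_0[OF assms(1-3)])
      fix k
      assume k: "k < N"
      define xk where "xk = vec (d k) (\<lambda>c. x (off k + c))"
      have xk: "xk \<in> carrier_vec (d k)"
        by (simp add: xk_def)
      have "V k \<in> carrier_mat n (d k)"
        using Vr[OF k] d_def by (intro carrier_matI) simp_all
      then have "(V k *\<^sub>v xk) $ r = y r" if "r < n" for r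
        using mult_mat_vec_index[OF _ xk that] block[OF k that] by (simp add: xk_def del: index_mult_mat_vec)
      then have "vec n y = V k *\<^sub>v xk"
        using Vr[OF k] by (intro eq_vecI) (simp_all del: index_mult_mat_vec)
      then show "obs_mat n (C k) A *\<^sub>v vec n y = 0\<^sub>v (dim_row (obs_mat n (C k) A))"
        using orthonormal_kernel_basis_mult_eq_0[OF obs_mat_carrier[OF assms(1)] basis[OF k] xk[unfolded d_def]]
        by simp
    qed simp_all
    then have "y r = 0" if "r < n" for r
      using that by (metis index_vec index_zero_vec(1))
    then have zero: "x (off k + c) = 0" if "k < N" "c < d k" for k c
      using orthonormal_kernel_basis_inj[OF basis[OF that(1)], of "\<lambda>c. x (off k + c)" c] that
        block[OF that(1)] by (simp add: d_def)
    show ?thesis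
      using concat_blocks_index[of _ d N] zero unfolding D_def off_def by blast
  qed

  \<comment> \<open>Lyapunov function of the averaged system\<close>
  have Wavg: "weighted_graph N Wavg"
    using assms(10) by (simp add: uniformly_connected_on_average_def)
  obtain \<theta> :: "nat \<Rightarrow> real" where \<theta>: "\<And>i. i < N \<Longrightarrow> 0 < \<theta> i"
    "\<And>j. j < N \<Longrightarrow> (\<Sum>i<N. \<theta> i * laplacian N Wavg $$ (i, j)) = 0"
    using laplacian_positive_left_null[OF Wavg assms(11)] by blast
  define G where "G k l i j = (\<Sum>r<n. U k r i * U l r j)" for k l i j
  have "\<exists>\<mu>>0. \<forall>x. \<mu> * (\<Sum>j<D. (x j)\<^sup>2) \<le>
      (\<Sum>i<D. \<theta> (\<beta> i) * x i * (\<Sum>j<D. (\<Sum>k<N. \<Sum>l<N. laplacian N Wavg $$ (k, l) * G k l i j) * x j))"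
    unfolding G_def by (rule coupling_coercive) (fact Wavg assms(11) \<theta> \<beta>(2) inj)+
  then obtain \<mu> where \<mu>: "0 < \<mu>" and coercive: "\<And>x. \<mu> * (\<Sum>j<D. (x j)\<^sup>2) \<le>
      (\<Sum>i<D. \<theta> (\<beta> i) * x i * (\<Sum>j<D. (\<Sum>k<N. \<Sum>l<N. laplacian N Wavg $$ (k, l) * G k l i j) * x j))"
    by blast
  \<comment> \<open>\<open>C0\<close> bounds the contribution of \<open>Au\<close> to the weighted
    form. Beyond \<open>(C0 + 1) / \<mu>\<close> the coupling outweighs it with a margin of
    \<open>1\<close>, which becomes the constant \<open>c\<close> of the averaging lemma.\<close>
  define C0 where "C0 = (\<Sum>i<D. \<Sum>j<D. \<bar>\<theta> (\<beta> i) * Au $$ (i, j)\<bar>)"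
  have C0: "0 \<le> C0"
    by (simp add: C0_def sum_nonneg)
  \<comment> \<open>Entries of the system matrix as an affine function of the Laplacian
    \<open>L\<close>; the switched and the averaged system differ only in this argument.\<close>
  define F where "F \<gamma> L i j = Au $$ (i, j) - \<gamma> * (\<Sum>k<N. \<Sum>l<N. L $$ (k, l) * G k l i j)"
    for \<gamma> and L :: "real mat" and i j
  have lyap: "(\<Sum>i<D. \<theta> (\<beta> i) * x i * (\<Sum>j<D. F \<gamma> (laplacian N Wavg) i j * x j)) \<le> - 1 * (\<Sum>i<D. (x i)\<^sup>2)"
    if \<gamma>: "(C0 + 1) / \<mu> < \<gamma>" for \<gamma> x
  proof -
    let ?X = "\<Sum>i<D. (x i)\<^sup>2"
    let ?Q = "\<Sum>i<D. \<theta> (\<beta> i) * x i * (\<Sum>j<D. (\<Sum>k<N. \<Sum>l<N. laplacian N Wavg $$ (k, l) * G k l i j) * x j)"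
    have "0 \<le> (C0 + 1) / \<mu>"
      using C0 \<mu> by simp
    then have \<gamma>0: "0 \<le> \<gamma>"
      using \<gamma> by linarith
    have "(\<Sum>i<D. \<theta> (\<beta> i) * x i * (\<Sum>j<D. F \<gamma> (laplacian N Wavg) i j * x j)) =
      (\<Sum>i<D. x i * (\<Sum>j<D. (\<theta> (\<beta> i) * Au $$ (i, j)) * x j)) - \<gamma> * ?Q"
      unfolding F_def left_diff_distrib sum_subtractf right_diff_distrib
      by (simp add: sum_distrib_left sum_distrib_right mult_ac)
    also have "\<dots> \<le> C0 * ?X - \<gamma> * (\<mu> * ?X)"
      unfolding C0_def using coercive \<gamma>0 by (intro diff_mono quadratic_form_le mult_left_mono)
    also have "\<dots> = (C0 - \<gamma> * \<mu>) * ?X"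
      by (simp add: algebra_simps)
    also have "\<dots> \<le> - 1 * ?X"
      using \<gamma> \<mu> by (intro mult_right_mono sum_nonneg) (auto simp: field_simps)
    finally show ?thesis .
  qed

  \<comment> \<open>Bounds and averages of the switched matrix\<close>
  define m where "m \<gamma> s = F \<gamma> (laplacian N (W (\<sigma> s)))" for \<gamma> s
  have \<sigma>: "\<sigma> s \<in> {1..p}" if "0 \<le> s" for s
    using assms(8) that by (simp add: switching_signal_def)
  have L_intble: "(\<lambda>s. laplacian N (W (\<sigma> s)) $$ (k, l)) integrable_on {a..b}" if "0 \<le> a" for k l a b
    by (rule switching_signal_integrable[OF assms(8) that])
  have m_intble: "(\<lambda>s. m \<gamma> s i j) integrable_on {a..b}" if "0 \<le> a" for \<gamma> i j a b
    unfolding m_def by (rule switching_signal_integrable[OF assms(8) that])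
  have m_bound: "\<exists>K>0. \<forall>s\<ge>0. \<forall>i<D. \<forall>j<D. \<bar>m \<gamma> s i j\<bar> \<le> K" for \<gamma>
  proof -
    \<comment> \<open>The signal takes finitely many values, so a maximum over the modes bounds all
      entries for all times; inserting \<open>1\<close> makes it positive.\<close>
    define Y where "Y = insert 1 ((\<lambda>(r, i, j). \<bar>F \<gamma> (laplacian N (W r)) i j\<bar>) ` ({1..p} \<times> {..<D} \<times> {..<D}))"
    have fin: "finite Y"
      by (simp add: Y_def)
    have "1 \<le> Max Y"
      using fin by (rule Max_ge) (simp add: Y_def)
    moreover have "\<bar>m \<gamma> s i j\<bar> \<le> Max Y" if "0 \<le> s" "i < D" "j < D" for s i j
      using fin
    proof (rule Max_ge)
      show "\<bar>m \<gamma> s i j\<bar> \<in> Y"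
        using \<sigma>[OF that(1)] that unfolding Y_def m_def by force
    qed
    ultimately show ?thesis
      by (intro exI[of _ "Max Y"]) auto
  qed
  obtain \<delta> :: "real \<Rightarrow> real" where \<delta>: "(\<delta> \<longlongrightarrow> 0) at_top"
    and close: "\<And>t T. 0 \<le> t \<Longrightarrow> 0 < T \<Longrightarrow>
      mnorm (average_laplacian N W \<sigma> t T - laplacian N Wavg) \<le> \<delta> T"
    using assms(10) by (auto simp: uniformly_connected_on_average_def)
  have m_avg: "\<exists>T>0. \<forall>t\<ge>0. \<forall>i<D. \<forall>j<D.
      \<bar>1 / T * integral {t..t + T} (\<lambda>s. m \<gamma> s i j) - F \<gamma> (laplacian N Wavg) i j\<bar> \<le> e"
    if e: "0 < e" for \<gamma> e
  proof -
    \<comment> \<open>\<open>B\<close> dominates the sensitivity of every entry of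
      \<open>F \<gamma> L\<close> to entrywise changes of \<open>L\<close>, so
      \<open>\<delta> T < e / B\<close> suffices; the added \<open>1\<close> permits the
      division.\<close>
    define B where "B = \<bar>\<gamma>\<bar> * (\<Sum>i<D. \<Sum>j<D. \<Sum>k<N. \<Sum>l<N. \<bar>G k l i j\<bar>) + 1"
    have B: "0 < B"
      by (auto simp: B_def intro!: add_nonneg_pos mult_nonneg_nonneg sum_nonneg)
    have "\<forall>\<^sub>F T in at_top. \<delta> T < e / B \<and> 0 < T"
      using order_tendstoD(2)[OF \<delta>, of "e / B"] e B by (intro eventually_conj eventually_gt_at_top) auto
    then obtain T where T: "\<delta> T < e / B" "0 < T"
      using eventually_happens'[OF trivial_limit_at_top_linorder] by blast
    have "\<bar>1 / T * integral {t..t + T} (\<lambda>s. m \<gamma> s i j) - F \<gamma> (laplacian N Wavg) i j\<bar> \<le> e"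
      if t: "0 \<le> t" and ij: "i < D" "j < D" for t i j
    proof -
      define Lt where "Lt = average_laplacian N W \<sigma> t T"
      have Lt: "\<bar>Lt $$ (k, l) - laplacian N Wavg $$ (k, l)\<bar> \<le> \<delta> T" if "k < N" "l < N" for k l
      proof -
        have "\<bar>(Lt - laplacian N Wavg) $$ (k, l)\<bar> \<le> mnorm (Lt - laplacian N Wavg)"
          using that by (intro abs_index_le_mnorm) (auto simp: laplacian_def)
        then show ?thesis
          using close[OF t T(2)] that by (simp add: Lt_def laplacian_def)
      qed
      \<comment> \<open>Since \<open>F\<close> is affine in the Laplacian, the time average of the
        system matrix is the system matrix of the averaged Laplacian \<open>Lt\<close>.\<close>
      have "((\<lambda>s. m \<gamma> s i j) has_integral
          T * Au $$ (i, j) - \<gamma> * (\<Sum>k<N. \<Sum>l<N. (T * Lt $$ (k, l)) * G k l i j)) {t..t + T}"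
        unfolding m_def F_def
      proof (intro has_integral_diff has_integral_mult_right has_integral_sum has_integral_mult_left finite_lessThan)
        show "((\<lambda>s. Au $$ (i, j)) has_integral T * Au $$ (i, j)) {t..t + T}"
          using has_integral_const_real[of "Au $$ (i, j)" t "t + T"] T by simp
        fix k l
        assume "k \<in> {..<N}" "l \<in> {..<N}"
        then show "((\<lambda>s. laplacian N (W (\<sigma> s)) $$ (k, l)) has_integral T * Lt $$ (k, l)) {t..t + T}"
          using integrable_integral[OF L_intble[OF t, of k l "t + T"]] T
          by (simp add: Lt_def average_laplacian_def)
      qed
      then have "1 / T * integral {t..t + T} (\<lambda>s. m \<gamma> s i j) = F \<gamma> Lt i j"
        using T by (simp add: integral_unique F_def right_diff_distrib sum_distrib_left mult_ac)
      also have "\<dots> - F \<gamma> (laplacian N Wavg) i j =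
          - \<gamma> * (\<Sum>k<N. \<Sum>l<N. (Lt $$ (k, l) - laplacian N Wavg $$ (k, l)) * G k l i j)"
        by (simp add: F_def left_diff_distrib sum_subtractf algebra_simps)
      finally have "\<bar>1 / T * integral {t..t + T} (\<lambda>s. m \<gamma> s i j) - F \<gamma> (laplacian N Wavg) i j\<bar> =
          \<bar>\<gamma>\<bar> * \<bar>\<Sum>k<N. \<Sum>l<N. (Lt $$ (k, l) - laplacian N Wavg $$ (k, l)) * G k l i j\<bar>"
        by (simp add: abs_mult)
      also have "\<dots> \<le> \<bar>\<gamma>\<bar> * (\<Sum>k<N. \<Sum>l<N. \<delta> T * \<bar>G k l i j\<bar>)"
        by (intro mult_left_mono order_trans[OF sum_abs] sum_mono)
          (auto simp: abs_mult intro!: mult_right_mono Lt)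
      also have "\<dots> = \<delta> T * (\<bar>\<gamma>\<bar> * (\<Sum>k<N. \<Sum>l<N. \<bar>G k l i j\<bar>))"
        by (simp add: sum_distrib_left mult_ac)
      also have "\<dots> \<le> e / B * (\<bar>\<gamma>\<bar> * (\<Sum>k<N. \<Sum>l<N. \<bar>G k l i j\<bar>))"
        using T by (intro mult_right_mono mult_nonneg_nonneg sum_nonneg) auto
      also have "\<dots> \<le> e / B * B"
      proof (intro mult_left_mono)
        have "(\<Sum>k<N. \<Sum>l<N. \<bar>G k l i j\<bar>) \<le> (\<Sum>j<D. \<Sum>k<N. \<Sum>l<N. \<bar>G k l i j\<bar>)"
          using ij by (intro member_le_sum[of j]) (auto intro!: sum_nonneg)
        also have "\<dots> \<le> (\<Sum>i<D. \<Sum>j<D. \<Sum>k<N. \<Sum>l<N. \<bar>G k l i j\<bar>)"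
          using ij by (intro member_le_sum[of i]) (auto intro!: sum_nonneg)
        finally have "\<bar>\<gamma>\<bar> * (\<Sum>k<N. \<Sum>l<N. \<bar>G k l i j\<bar>) \<le> \<bar>\<gamma>\<bar> * (\<Sum>i<D. \<Sum>j<D. \<Sum>k<N. \<Sum>l<N. \<bar>G k l i j\<bar>)"
          by (intro mult_left_mono) auto
        then show "\<bar>\<gamma>\<bar> * (\<Sum>k<N. \<Sum>l<N. \<bar>G k l i j\<bar>) \<le> B"
          by (simp add: B_def)
        show "0 \<le> e / B"
          using e B by simp
      qed
      finally show ?thesis
        using B by simp
    qed
    with T(2) show ?thesis
      by blast
  qed

  \<comment> \<open>Solutions of the switched system\<close>
  have system: "((Au - \<gamma> \<cdot>\<^sub>m (transpose_mat Vu * kronecker (laplacian N (W (\<sigma> s))) (1\<^sub>m n) * Vu)) *\<^sub>v z) $ i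
      = (\<Sum>j<D. m \<gamma> s i j * z $ j)" if "i < D" "z \<in> carrier_vec D" for \<gamma> s z i
  proof -
    let ?X = "transpose_mat Vu * kronecker (laplacian N (W (\<sigma> s))) (1\<^sub>m n) * Vu"
    have dimX: "dim_row ?X = D" "dim_col ?X = D"
      using carrier_matD[OF Vu] by simp_all
    then have c: "Au - \<gamma> \<cdot>\<^sub>m ?X \<in> carrier_mat D D"
      by (intro carrier_matI) simp_all
    show ?thesis
      unfolding mult_mat_vec_index[OF c that(2,1)]
    proof (intro sum.cong refl)
      fix j
      assume "j \<in> {..<D}"
      then have "(Au - \<gamma> \<cdot>\<^sub>m ?X) $$ (i, j) = Au $$ (i, j) - \<gamma> * ?X $$ (i, j)"
        using that dimX by (simp del: index_mult_mat(1))
      also have "?X $$ (i, j) = (\<Sum>k<N. \<Sum>l<N. laplacian N (W (\<sigma> s)) $$ (k, l) * G k l i j)"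
        unfolding G_def U_def
        by (rule mult_kronecker_one_mult_index[OF Vu laplacian_carrier]) (use that \<open>j \<in> {..<D}\<close> in auto)
      finally show "(Au - \<gamma> \<cdot>\<^sub>m ?X) $$ (i, j) * z $ j = m \<gamma> s i j * z $ j"
        by (simp add: m_def F_def)
    qed
  qed
  have stable: "\<exists>\<epsilon>s>0. \<forall>\<epsilon>. 0 < \<epsilon> \<and> \<epsilon> < \<epsilon>s \<longrightarrow> ltv_exponentially_stable (dim_row Au)
      (\<lambda>t. Au - \<gamma> \<cdot>\<^sub>m (transpose_mat Vu * kronecker (laplacian N (W (\<sigma> (t / \<epsilon>)))) (1\<^sub>m n) * Vu))"
    if \<gamma>: "(C0 + 1) / \<mu> < \<gamma>" for \<gamma>
  proof -
    obtain K where K: "0 < K" "\<And>s i j. 0 \<le> s \<Longrightarrow> i < D \<Longrightarrow> j < D \<Longrightarrow> \<bar>m \<gamma> s i j\<bar> \<le> K"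
      using m_bound[of \<gamma>] by blast
    have \<theta>\<beta>: "0 < \<theta> (\<beta> i)" if "i < D" for i
      by (rule \<theta>(1)[OF \<beta>(1)[OF that]])
    have "\<exists>\<epsilon>s>0. \<forall>\<epsilon>. 0 < \<epsilon> \<and> \<epsilon> < \<epsilon>s \<longrightarrow> (\<exists>k>0. \<exists>\<alpha>>0. \<forall>t0\<ge>0. \<forall>z S.
        (\<forall>i<D. continuous_on {t0..} (\<lambda>t. z t i)) \<longrightarrow> (\<forall>t. finite (S \<inter> {t0..t})) \<longrightarrow>
        (\<forall>t\<in>{t0<..} - S. \<forall>i<D.
          ((\<lambda>s. z s i) has_real_derivative (\<Sum>j<D. m \<gamma> (t / \<epsilon>) i j * z t j)) (at t)) \<longrightarrow>
        (\<forall>t\<ge>t0. L2_set (z t) {..<D} \<le> k * L2_set (z t0) {..<D} * exp (- \<alpha> * (t - t0))))"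
    proof (rule averaging_exponential_stability[where p = "\<lambda>i. \<theta> (\<beta> i)" and c = 1])
      show "\<bar>m \<gamma> s i j\<bar> \<le> K" if "0 \<le> s" "i < D" "j < D" for s i j
        by (rule K(2)[OF that])
      show "(\<lambda>s. m \<gamma> s i j) integrable_on {a..b}" if "0 \<le> a" for i j a b
        by (rule m_intble[OF that])
      show "\<exists>T>0. \<forall>t\<ge>0. \<forall>i<D. \<forall>j<D.
          \<bar>1 / T * integral {t..t + T} (\<lambda>s. m \<gamma> s i j) - F \<gamma> (laplacian N Wavg) i j\<bar> \<le> e" if "0 < e" for e
        by (rule m_avg[OF that])
      show "(0 :: real) < 1"
        by simp
      show "(\<Sum>i<D. \<theta> (\<beta> i) * x i * (\<Sum>j<D. F \<gamma> (laplacian N Wavg) i j * x j)) \<le> - 1 * (\<Sum>i<D. (x i)\<^sup>2)"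
        for x
        by (rule lyap[OF \<gamma>])
    qed (fact K(1) \<theta>\<beta>)+
    then obtain \<epsilon>s where \<epsilon>s: "0 < \<epsilon>s" and decay: "\<And>\<epsilon>. 0 < \<epsilon> \<and> \<epsilon> < \<epsilon>s \<Longrightarrow>
      \<exists>k>0. \<exists>\<alpha>>0. \<forall>t0\<ge>0. \<forall>z S.
        (\<forall>i<D. continuous_on {t0..} (\<lambda>t. z t i)) \<longrightarrow> (\<forall>t. finite (S \<inter> {t0..t})) \<longrightarrow>
        (\<forall>t\<in>{t0<..} - S. \<forall>i<D.
          ((\<lambda>s. z s i) has_real_derivative (\<Sum>j<D. m \<gamma> (t / \<epsilon>) i j * z t j)) (at t)) \<longrightarrow>
        (\<forall>t\<ge>t0. L2_set (z t) {..<D} \<le> k * L2_set (z t0) {..<D} * exp (- \<alpha> * (t - t0)))"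
      by blast
    have "ltv_exponentially_stable (dim_row Au)
      (\<lambda>t. Au - \<gamma> \<cdot>\<^sub>m (transpose_mat Vu * kronecker (laplacian N (W (\<sigma> (t / \<epsilon>)))) (1\<^sub>m n) * Vu))"
      if \<epsilon>: "0 < \<epsilon> \<and> \<epsilon> < \<epsilon>s" for \<epsilon>
    proof -
      let ?M = "\<lambda>t. Au - \<gamma> \<cdot>\<^sub>m (transpose_mat Vu * kronecker (laplacian N (W (\<sigma> (t / \<epsilon>)))) (1\<^sub>m n) * Vu)"
      obtain k \<alpha> where k: "0 < k" "0 < \<alpha>" and dec: "\<forall>t0\<ge>0. \<forall>z S.
          (\<forall>i<D. continuous_on {t0..} (\<lambda>t. z t i)) \<longrightarrow> (\<forall>t. finite (S \<inter> {t0..t})) \<longrightarrow>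
          (\<forall>t\<in>{t0<..} - S. \<forall>i<D.
            ((\<lambda>s. z s i) has_real_derivative (\<Sum>j<D. m \<gamma> (t / \<epsilon>) i j * z t j)) (at t)) \<longrightarrow>
          (\<forall>t\<ge>t0. L2_set (z t) {..<D} \<le> k * L2_set (z t0) {..<D} * exp (- \<alpha> * (t - t0)))"
        using decay[OF \<epsilon>] by blast
      have "vnorm (z t) \<le> k * vnorm (z t0) * exp (- \<alpha> * (t - t0))"
        if t0: "0 \<le> t0" and sol: "ltv_solution D ?M t0 z" and t: "t0 \<le> t" for t0 z t
      proof -
        have zc: "z s \<in> carrier_vec D" if "t0 \<le> s" for s
          using sol that by (simp add: ltv_solution_def)
        \<comment> \<open>\<open>vnorm\<close> depends on the dimension of its argument, and a
          solution is known to have dimension \<open>D\<close> only from \<open>t0\<close>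
          on.\<close>
        have norm: "vnorm (z s) = L2_set (\<lambda>i. z s $ i) {..<D}" if "t0 \<le> s" for s
          using carrier_vecD[OF zc[OF that]] by (simp add: vnorm_eq_L2_set)
        obtain S where S: "\<forall>t. finite (S \<inter> {t0..t})"
          and deriv: "\<forall>t\<in>{t0<..} - S. \<forall>k<D. ((\<lambda>s. z s $ k) has_real_derivative (?M t *\<^sub>v z t) $ k) (at t)"
          using sol unfolding ltv_solution_def by blast
        have deriv': "\<forall>t\<in>{t0<..} - S. \<forall>i<D.
            ((\<lambda>s. z s $ i) has_real_derivative (\<Sum>j<D. m \<gamma> (t / \<epsilon>) i j * z t $ j)) (at t)"
        proof (intro ballI allI impI)
          fix t i
          assume ti: "t \<in> {t0<..} - S" "i < D"
          then have "t0 \<le> t"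
            by simp
          have "((\<lambda>s. z s $ i) has_real_derivative (?M t *\<^sub>v z t) $ i) (at t)"
            using deriv ti by blast
          then show "((\<lambda>s. z s $ i) has_real_derivative (\<Sum>j<D. m \<gamma> (t / \<epsilon>) i j * z t $ j)) (at t)"
            unfolding system[OF ti(2) zc[OF \<open>t0 \<le> t\<close>]] .
        qed
        have cont: "\<forall>i<D. continuous_on {t0..} (\<lambda>t. z t $ i)"
          using sol unfolding ltv_solution_def by blast
        have "L2_set (\<lambda>i. z t $ i) {..<D} \<le> k * L2_set (\<lambda>i. z t0 $ i) {..<D} * exp (- \<alpha> * (t - t0))"
          by (rule dec[THEN spec, THEN mp, OF t0, THEN spec[of _ "\<lambda>s i. z s $ i"], THEN spec[of _ S],
                THEN mp, OF cont, THEN mp, OF S, THEN mp, OF deriv', THEN spec, THEN mp, OF t])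
        then show ?thesis
          by (simp only: norm[OF t] norm[OF order_refl])
      qed
      with k show ?thesis
        unfolding ltv_exponentially_stable_def carrier_matD(1)[OF Au] by blast
    qed
    with \<epsilon>s show ?thesis
      by blast
  qed
  show ?thesis
    using C0 \<mu> by (intro exI[of _ "(C0 + 1) / \<mu>"] conjI allI impI stable) auto
qed

end
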